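(* Let $t^\ast=\pi p/q$ be a rational time, where $p,q$ are positive integers with no common factors. Let $u(t,x)$ be the solution of the periodic initial-boundary value problem on $0\le x\le 2\pi$ for the linear beam equation $u_{tt}+u_{xxxx}=0$, with $\partial_x^j u(t,0)=\partial_x^j u(t,2\pi)$ and $\partial_x^j\partial_t u(t,0)=\partial_x^j\partial_t u(t,2\pi)$ for $j=0,1,2,3$, and with initial data $u(0,x)=u_t(0,x)=\sigma(x)$, where $\sigma(x)=-1$ for $0\le x<\pi$ and $\sigma(x)=1$ for $\pi\le x<2\pi$. Then $$u(t^\ast,x)=\sum_{j=0}^{2q-1}a_j\left(\frac pq\right)\sigma^{j,q}(x)-H(x)+C(t^\ast)\,x,$$ where $$C(t^\ast)=-\frac{4}{\pi}\sum_{n=0}^{\infty}\frac{\sin((2n+1)^2t^\ast)}{(2n+1)^2},$$ $H$ is the piecewise quadratic function $$H(x)=\int_0^x\int_0^y\sum_{j=0}^{2q-1}b_j\left(\frac pq\right)\sigma^{j,q}(z)\,dz\,dy,$$ and $a_j,b_j$, $j=0,\dots,2q-1$, are certain real constants depending on $p$ and $q$, determined by $$-\frac{4}{\pi}\sum_{n=0}^{\infty}\frac{\cos\left((2n+1)^2\frac{\pi p}{q}\right)}{2n+1}\sin((2n+1)x)=\sum_{j=0}^{2q-1}a_j\left(\frac pq\right)\sigma^{j,q}(x),$$ $$-\frac{4}{\pi}\sum_{n=0}^{\infty}\frac{\sin\left((2n+1)^2\frac{\pi p}{q}\right)}{2n+1}\sin((2n+1)x)=\sum_{j=0}^{2q-1}b_j\left(\frac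 pq\right)\sigma^{j,q}(x).$$
   Context: For integers $q\ge 1$ and $0\le j\le 2q-1$, the box function $\sigma^{j,q}(x)$ equals $1$ for $\pi j/q\le x<\pi(j+1)/q$ and $0$ otherwise. Functions defined on $[0,2\pi]$ are extended $2\pi$-periodically when required. The solution of the stated problem is given by the Fourier series $$u(t,x)=-\frac{4}{\pi}\left(\sum_{n=0}^{\infty}\frac{\cos((2n+1)^2t)\sin((2n+1)x)}{2n+1}+\sum_{n=0}^{\infty}\frac{\sin((2n+1)^2t)\sin((2n+1)x)}{(2n+1)^3}\right).$$
   Formalization: The identities are stated for x in [0,2π] off the break points πj/q, since at a jump the Fourier series takes the midpoint and not the box value (p=q=1, x=0: 0 versus a_0=1); for u understood as a weak solution of the problem the formula holds almost everywhere. *)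

theory Defs imports "HOL-Analysis.Analysis" begin

definition box :: "nat \<Rightarrow> nat \<Rightarrow> real \<Rightarrow> real" where
  "box j q x = (if pi * real j / real q \<le> x \<and> x < pi * real (j + 1) / real q then 1 else 0)"

definition box_sum :: "nat \<Rightarrow> (nat \<Rightarrow> real) \<Rightarrow> real \<Rightarrow> real" where
  "box_sum q c x = (\<Sum>j = 0..2 * q - 1. c j * box j q x)"

definition grid :: "nat \<Rightarrow> real set" where
  "grid q = {pi * real j / real q | j. j \<le> 2 * q}"

text \<open>Pointwise, the Fourier series of a step function converges at a jump to the mean of the
  one-sided limits and not to the right-continuous value of the box functions. Identities between
  Fourier series and box functions are therefore stated on \<open>[0, 2\<pi>]\<close> off the break points.\<close>

definition has_box_expansion ::
    "nat \<Rightarrow> (nat \<Rightarrow> real \<Rightarrow> real) \<Rightarrow> (nat \<Rightarrow> real) \<Rightarrow> bool" where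
  "has_box_expansion q f c \<longleftrightarrow>
     (\<forall>x\<in>{0..2 * pi} - grid q. (\<lambda>n. f n x) sums box_sum q c x)"

text \<open>The coefficients with index above \<open>2 q - 1\<close> are irrelevant, hence the restricted uniqueness.\<close>

definition determined_by_box_expansion ::
    "nat \<Rightarrow> (nat \<Rightarrow> real \<Rightarrow> real) \<Rightarrow> (nat \<Rightarrow> real) \<Rightarrow> bool" where
  "determined_by_box_expansion q f c \<longleftrightarrow>
     has_box_expansion q f c \<and>
     (\<forall>c'. has_box_expansion q f c' \<longrightarrow> (\<forall>j\<le>2 * q - 1. c' j = c j))"

definition beam_H :: "nat \<Rightarrow> (nat \<Rightarrow> real) \<Rightarrow> real \<Rightarrow> real" where
  "beam_H q b x = integral {0..x} (\<lambda>y. integral {0..y} (\<lambda>z. box_sum q b z))"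

definition beam_C :: "real \<Rightarrow> real" where
  "beam_C t = - (4 / pi) * (\<Sum>n. sin ((2 * real n + 1)^2 * t) / (2 * real n + 1)^2)"

definition beam_series :: "real \<Rightarrow> real \<Rightarrow> real" where
  "beam_series t x = - (4 / pi) *
     ((\<Sum>n. cos ((2 * real n + 1)^2 * t) * sin ((2 * real n + 1) * x) / (2 * real n + 1)) +
      (\<Sum>n. sin ((2 * real n + 1)^2 * t) * sin ((2 * real n + 1) * x) / (2 * real n + 1)^3))"

text \<open>The step data on \<open>[0, 2\<pi>]\<close>; the value at \<open>2\<pi>\<close> is that of the periodic extension.\<close>

definition step_data :: "real \<Rightarrow> real" where
  "step_data x = (if pi \<le> x \<and> x < 2 * pi then 1 else -1)"

text \<open>Since the initial data are discontinuous, the periodic initial-boundary value problem for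
  \<open>u\<^sub>t\<^sub>t + u\<^sub>x\<^sub>x\<^sub>x\<^sub>x = 0\<close> has no classical solution and is understood weakly in \<open>x\<close>. Testing with
  \<open>C\<^sup>4\<close> functions subject to the same boundary conditions on the derivatives of order
  \<open>0, 1, 2, 3\<close>, four integrations by parts turn the equation together with the boundary
  conditions on \<open>u\<close> into the requirement that the second time derivative of \<open>\<langle>u, \<phi>\<rangle>\<close> is
  \<open>- \<langle>u, \<phi>\<^sub>x\<^sub>x\<^sub>x\<^sub>x\<rangle>\<close>. In \<open>beam_test_function \<phi>\<close>, the test function is \<open>\<phi> 0\<close> and \<open>\<phi> i\<close> is its
  derivative of order \<open>i\<close>.\<close>

definition beam_test_function :: "(nat \<Rightarrow> real \<Rightarrow> real) \<Rightarrow> bool" where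
  "beam_test_function \<phi> \<longleftrightarrow>
     (\<forall>i<4. \<forall>x\<in>{0..2 * pi}. (\<phi> i has_real_derivative \<phi> (Suc i) x) (at x within {0..2 * pi})) \<and>
     continuous_on {0..2 * pi} (\<phi> 4) \<and>
     (\<forall>i<4. \<phi> i 0 = \<phi> i (2 * pi))"

definition pairing :: "(real \<Rightarrow> real) \<Rightarrow> (real \<Rightarrow> real) \<Rightarrow> real" where
  "pairing f g = integral {0..2 * pi} (\<lambda>x. f x * g x)"

definition beam_solution ::
    "(real \<Rightarrow> real) \<Rightarrow> (real \<Rightarrow> real) \<Rightarrow> (real \<Rightarrow> real \<Rightarrow> real) \<Rightarrow> bool" where
  "beam_solution f g u \<longleftrightarrow>
     (\<forall>t\<ge>0. u t absolutely_integrable_on {0..2 * pi}) \<and>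
     (AE x in lebesgue_on {0..2 * pi}. u 0 x = f x) \<and>
     (\<forall>\<phi>. beam_test_function \<phi> \<longrightarrow>
        (\<exists>v. (\<forall>t\<ge>0. ((\<lambda>s. pairing (u s) (\<phi> 0)) has_real_derivative v t) (at t within {0..})) \<and>
             (\<forall>t\<ge>0. (v has_real_derivative - pairing (u t) (\<phi> 4)) (at t within {0..})) \<and>
             v 0 = pairing g (\<phi> 0)))"

end

theory Submission imports Defs begin

text \<open>At \<open>t = \<pi>p/q\<close> the phases \<open>cos (k\<^sup>2t)\<close> and \<open>sin (k\<^sup>2t)\<close> are even and \<open>2q\<close>-periodic in \<open>k\<close>, hence
  finite combinations of \<open>cos (\<pi>km/q)\<close> with \<open>m < 2q\<close>. Both box series are therefore finite
  combinations of translates by \<open>\<plusminus>\<pi>m/q\<close> of the square wave \<open>\<Sum> sin (kx)/k\<close> over odd \<open>k\<close>, whose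
  partial sums are bounded uniformly in \<open>x\<close>. Dominated convergence then permits integrating the
  series twice, which produces \<open>H\<close> and \<open>C\<close>.

  For a weak solution, testing with \<open>sin (mx + \<theta>)\<close> gives a harmonic oscillator of frequency \<open>m\<^sup>2\<close>,
  which the right-hand side satisfies as well by termwise integration. The difference is orthogonal
  to all \<open>sin (mx + \<theta>)\<close>, hence to all polynomials in \<open>cos (x - \<alpha>)\<close>, hence by the Weierstrass theorem
  to all continuous functions of \<open>cos (x - \<alpha>)\<close>. Indicators of intervals centred at \<open>\<alpha>\<close> are bounded
  limits of such functions, so the difference vanishes by the Lebesgue differentiation theorem.\<close>

subsection \<open>Partial sums of the square wave\<close>

text \<open>Partial Fourier sums of \<open>pi / 4 * sgn (sin y)\<close>. Multiplied by
  \<open>- (4 / pi)\<close> they become those of \<open>step_data\<close>.\<close>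

definition square_wave_sum :: "nat \<Rightarrow> real \<Rightarrow> real" where
  "square_wave_sum N y = (\<Sum>n<N. sin ((2 * real n + 1) * y) / (2 * real n + 1))"

text \<open>The reason is that \<open>sin ((2n + 1)y)\<close> is an odd polynomial in \<open>sin y\<close>.\<close>

lemma sin_odd_multiple_transfer:
  fixes s y z :: real
  assumes "sin y = s * sin z" and "s^2 = 1"
  shows "sin ((2 * real n + 1) * y) = s * sin ((2 * real n + 1) * z)"
proof -
  have c: "cos (2 * y) = cos (2 * z)"
    using assms by (simp add: cos_double_sin power_mult_distrib)
  have rec: "sin ((2 * real (Suc (Suc n)) + 1) * t)
      = 2 * sin ((2 * real (Suc n) + 1) * t) * cos (2 * t) - sin ((2 * real n + 1) * t)" for n t
  proof -
    have "sin ((2 * real (Suc n) + 1) * t + 2 * t) + sin ((2 * real (Suc n) + 1) * t - 2 * t)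
        = 2 * sin ((2 * real (Suc n) + 1) * t) * cos (2 * t)"
      by (simp add: sin_add sin_diff)
    moreover have "(2 * real (Suc n) + 1) * t + 2 * t = (2 * real (Suc (Suc n)) + 1) * t"
      "(2 * real (Suc n) + 1) * t - 2 * t = (2 * real n + 1) * t"
      by (simp_all add: algebra_simps)
    ultimately show ?thesis by simp
  qed
  \<comment> \<open>The recurrence is of second order, so two consecutive odd multiples are carried
    through the induction.\<close>
  have "sin ((2 * real n + 1) * y) = s * sin ((2 * real n + 1) * z) \<and>
        sin ((2 * real (Suc n) + 1) * y) = s * sin ((2 * real (Suc n) + 1) * z)"
  proof (induction n)
    case 0
    have "sin (3 * t) = sin t * (2 * cos (2 * t) + 1)" for t :: real
    proof -
      have "sin (3 * t) = sin (2 * t + t)" by simp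
      also have "\<dots> = sin t * (2 * cos t * cos t + cos (2 * t))"
        by (simp only: sin_add sin_double) (simp add: algebra_simps)
      also have "2 * cos t * cos t = cos (2 * t) + 1"
        by (simp add: cos_double_cos power2_eq_square)
      finally show ?thesis by (simp add: algebra_simps)
    qed
    then show ?case using assms c by simp
  next
    case (Suc n)
    then show ?case by (simp only: rec c) (simp add: algebra_simps)
  qed
  then show ?thesis by simp
qed

text \<open>With \<open>s = sgn (sin y)\<close> this moves every argument with nonzero sine into the
  quadrant \<open>0 < z \<le> pi / 2\<close>, where the estimates are made.\<close>

lemma square_wave_sum_transfer:
  assumes "sin y = s * sin z" and "s^2 = 1"
  shows "square_wave_sum N y = s * square_wave_sum N z"
  unfolding square_wave_sum_def sum_distrib_left
  by (intro sum.cong refl) (simp add: sin_odd_multiple_transfer[OF assms])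

text \<open>Each summand times \<open>2 * sin y\<close> is a difference of sines of consecutive even
  multiples, so the sum telescopes.\<close>

lemma sum_cos_odd_multiples: "2 * sin y * (\<Sum>n<N. cos ((2 * real n + 1) * y)) = sin (2 * real N * y)"
proof (induction N)
  case (Suc N)
  have "2 * sin y * cos ((2 * real N + 1) * y)
      = sin ((2 * real N + 1) * y + y) - sin ((2 * real N + 1) * y - y)"
    by (simp add: sin_add sin_diff)
  also have "(2 * real N + 1) * y + y = 2 * real (Suc N) * y" by (simp add: algebra_simps)
  also have "(2 * real N + 1) * y - y = 2 * real N * y" by (simp add: algebra_simps)
  finally show ?case using Suc by (simp add: distrib_left)
qed simp

lemma square_wave_sum_deriv:
  assumes "sin y \<noteq> 0"
  shows "(square_wave_sum N has_real_derivative sin (2 * real N * y) / (2 * sin y)) (at y)"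
proof -
  have "((\<lambda>y. sin ((2 * real n + 1) * y) / (2 * real n + 1)) has_real_derivative
      cos ((2 * real n + 1) * y)) (at y)" for n :: nat
    by (auto intro!: derivative_eq_intros simp: add_nonneg_eq_0_iff)
  then have "(square_wave_sum N has_real_derivative (\<Sum>n<N. cos ((2 * real n + 1) * y))) (at y)"
    unfolding square_wave_sum_def[abs_def] by (intro DERIV_sum)
  moreover have "(\<Sum>n<N. cos ((2 * real n + 1) * y)) = sin (2 * real N * y) / (2 * sin y)"
    using assms sum_cos_odd_multiples[of y N] by (simp add: field_simps)
  ultimately show ?thesis by simp
qed

text \<open>The comparison point \<open>pi / 2\<close> is where the limit is known from the Leibniz
  series. At fixed \<open>y\<close> the bound gives convergence; its dependence on the product of
  \<open>N\<close> and \<open>sin y\<close> alone serves the uniform bound.\<close>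

lemma square_wave_sum_tail_quadrant:
  assumes y: "0 < y" "y \<le> pi / 2" and N: "N > 0"
  shows "\<bar>square_wave_sum N y - square_wave_sum N (pi / 2)\<bar> \<le> 1 / (2 * real N * sin y)"
proof -
  \<comment> \<open>Integrating \<open>sin (2Ns) / (2 sin s)\<close> by parts produces the correction term in \<open>g\<close>, after which
    the derivative of \<open>g\<close> is dominated by that of \<open>r\<close>.\<close>
  define r where "r s = 1 / (4 * real N * sin s)" for s :: real
  define g where "g s = square_wave_sum N s + cos (2 * real N * s) * r s" for s
  have pos: "sin s > 0" if "s \<in> {y..pi/2}" for s
    using that y by (intro sin_gt_zero) auto
  have cpos: "cos s \<ge> 0" if "s \<in> {y..pi/2}" for s
    using that y by (intro cos_ge_zero) auto
  have dr: "(r has_real_derivative - cos s / (4 * real N * (sin s)^2)) (at s)"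
    if "s \<in> {y..pi/2}" for s
    unfolding r_def[abs_def] using pos[OF that] N
    by (auto intro!: derivative_eq_intros simp: field_simps power2_eq_square)
  have dg: "(g has_real_derivative - cos (2 * real N * s) * cos s / (4 * real N * (sin s)^2)) (at s)"
    if "s \<in> {y..pi/2}" for s
    unfolding g_def[abs_def] using pos[OF that] N
    by (auto intro!: derivative_eq_intros square_wave_sum_deriv dr[OF that]
        simp: r_def field_simps power2_eq_square)
  have "g (pi/2) + r (pi/2) \<le> g y + r y"
  proof (rule DERIV_nonpos_imp_nonincreasing[where f = "\<lambda>s. g s + r s"])
    show "y \<le> pi / 2" by fact
    fix s assume "y \<le> s" "s \<le> pi / 2"
    then have s: "s \<in> {y..pi/2}" by auto
    have one_plus: "0 \<le> 1 + cos (2 * real N * s)"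
      using cos_ge_minus_one[of "2 * real N * s"] by linarith
    have "- (cos s * (1 + cos (2 * real N * s)) / (4 * real N * (sin s)^2)) \<le> 0"
      using cpos[OF s] one_plus by (auto intro!: divide_nonneg_nonneg mult_nonneg_nonneg)
    moreover have "((\<lambda>s. g s + r s) has_real_derivative
        - (cos s * (1 + cos (2 * real N * s)) / (4 * real N * (sin s)^2))) (at s)"
      by (rule DERIV_cong[OF DERIV_add[OF dg[OF s] dr[OF s]]])
        (simp add: add_divide_distrib[symmetric] diff_divide_distrib[symmetric] algebra_simps)
    ultimately show "\<exists>D. ((\<lambda>s. g s + r s) has_real_derivative D) (at s) \<and> D \<le> 0" by blast
  qed
  moreover have "g y - r y \<le> g (pi/2) - r (pi/2)"
  proof (rule DERIV_nonneg_imp_nondecreasing[where f = "\<lambda>s. g s - r s"])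
    show "y \<le> pi / 2" by fact
    fix s assume "y \<le> s" "s \<le> pi / 2"
    then have s: "s \<in> {y..pi/2}" by auto
    have "cos s * (1 - cos (2 * real N * s)) / (4 * real N * (sin s)^2) \<ge> 0"
      using cpos[OF s] cos_le_one[of "2 * real N * s"]
      by (auto intro!: divide_nonneg_nonneg mult_nonneg_nonneg)
    moreover have "((\<lambda>s. g s - r s) has_real_derivative
        cos s * (1 - cos (2 * real N * s)) / (4 * real N * (sin s)^2)) (at s)"
      by (rule DERIV_cong[OF DERIV_diff[OF dg[OF s] dr[OF s]]])
        (simp add: add_divide_distrib[symmetric] diff_divide_distrib[symmetric] algebra_simps)
    ultimately show "\<exists>D. ((\<lambda>s. g s - r s) has_real_derivative D) (at s) \<and> 0 \<le> D" by blast
  qed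
  moreover have "\<bar>cos (2 * real N * s) * r s\<bar> \<le> r s" if "s \<in> {y..pi/2}" for s
    using pos[OF that] by (simp add: r_def abs_mult divide_right_mono)
  from this[of y] this[of "pi/2"] y
  have "\<bar>cos (2 * real N * y) * r y\<bar> \<le> r y" "\<bar>cos (2 * real N * (pi/2)) * r (pi/2)\<bar> \<le> r (pi/2)"
    by auto
  \<comment> \<open>Monotonicity of \<open>g + r\<close> and \<open>g - r\<close> bounds the change
    of \<open>g\<close> by \<open>r y - r (pi/2)\<close>. The correction terms cost at most
    \<open>r y + r (pi/2)\<close>, and the values at \<open>pi/2\<close> cancel.\<close>
  ultimately have "\<bar>square_wave_sum N y - square_wave_sum N (pi / 2)\<bar> \<le> 2 * r y"
    unfolding g_def by linarith
  also have "2 * r y = 1 / (2 * real N * sin y)" by (simp add: r_def)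
  finally show ?thesis .
qed

lemma square_wave_sum_tail:
  assumes "sin y \<noteq> 0" and N: "N > 0"
  shows "\<bar>square_wave_sum N y - sgn (sin y) * square_wave_sum N (pi / 2)\<bar> \<le> 1 / (2 * real N * \<bar>sin y\<bar>)"
proof -
  define z where "z = arcsin \<bar>sin y\<bar>"
  have z: "sin z = \<bar>sin y\<bar>" "0 < z" "z \<le> pi / 2"
    using assms(1) arcsin_ubound[of "\<bar>sin y\<bar>"] arcsin_less_arcsin[of 0 "\<bar>sin y\<bar>"]
    by (auto simp: z_def intro!: sin_arcsin)
  have "square_wave_sum N y = sgn (sin y) * square_wave_sum N z"
    using assms(1) by (intro square_wave_sum_transfer) (auto simp: z(1) sgn_mult_abs sgn_if)
  then have "\<bar>square_wave_sum N y - sgn (sin y) * square_wave_sum N (pi / 2)\<bar>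
      = \<bar>square_wave_sum N z - square_wave_sum N (pi / 2)\<bar>"
    using assms(1) by (simp add: right_diff_distrib[symmetric] abs_mult abs_sgn_eq)
  then show ?thesis using square_wave_sum_tail_quadrant[OF z(2,3) N] z(1) by simp
qed

text \<open>At \<open>pi / 2\<close> the sines alternate in sign, which leaves the Leibniz
  series.\<close>

lemma square_wave_sum_half_pi: "(\<lambda>N. square_wave_sum N (pi / 2)) \<longlonglongrightarrow> pi / 4"
proof -
  have eq: "sin ((2 * real n + 1) * (pi / 2)) / (2 * real n + 1) = (-1)^n * 1 / real (n * 2 + 1)" for n
  proof -
    have "sin ((2 * real n + 1) * (pi / 2)) = sin (pi / 2 + real n * pi)" by (simp add: algebra_simps)
    also have "\<dots> = (-1)^n" by (simp add: sin_add cos_npi)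
    finally show ?thesis by (simp add: algebra_simps)
  qed
  have "summable (\<lambda>k. (- 1) ^ k * 1 / real (k * 2 + 1) * 1 ^ (k * 2 + 1) :: real)"
    using summable_arctan_series[of 1] by simp
  then have "(\<lambda>k. (- 1) ^ k * 1 / real (k * 2 + 1)) sums (pi / 4)"
    unfolding pi_series by (simp add: summable_sums)
  then show ?thesis unfolding square_wave_sum_def eq sums_def .
qed

lemma square_wave_sum_tendsto:
  assumes "sin y \<noteq> 0"
  shows "(\<lambda>N. square_wave_sum N y) \<longlonglongrightarrow> pi / 4 * sgn (sin y)"
proof -
  have "(\<lambda>N. square_wave_sum N y - sgn (sin y) * square_wave_sum N (pi / 2)) \<longlonglongrightarrow> 0"
  proof (rule Lim_null_comparison)
    show "\<forall>\<^sub>F N in sequentially.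
        norm (square_wave_sum N y - sgn (sin y) * square_wave_sum N (pi / 2)) \<le> 1 / (2 * \<bar>sin y\<bar>) * inverse (real N)"
      using eventually_gt_at_top[of 0]
      by eventually_elim (use square_wave_sum_tail[OF assms] in \<open>simp add: field_simps\<close>)
    show "(\<lambda>N. 1 / (2 * \<bar>sin y\<bar>) * inverse (real N)) \<longlonglongrightarrow> 0"
      by (intro tendsto_mult_right_zero lim_inverse_n)
  qed
  from tendsto_add[OF this tendsto_mult[OF tendsto_const[of "sgn (sin y)"] square_wave_sum_half_pi]]
  show ?thesis by (simp add: mult.commute)
qed

text \<open>Serves near the zeros of the sine, where the tail estimate degenerates. Passing to the
  next odd multiple adds a cosine times \<open>2 * sin y\<close>.\<close>

lemma abs_sin_odd_multiple_le: "\<bar>sin ((2 * real n + 1) * y)\<bar> \<le> (2 * real n + 1) * \<bar>sin y\<bar>"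
proof (induction n)
  case (Suc n)
  have eq: "sin ((2 * real (Suc n) + 1) * y) = sin ((2 * real n + 1) * y) + 2 * cos ((2 * real n + 2) * y) * sin y"
  proof -
    have "2 * cos ((2 * real n + 2) * y) * sin y = sin ((2 * real n + 2) * y + y) - sin ((2 * real n + 2) * y - y)"
      by (simp add: sin_add sin_diff)
    moreover have "(2 * real n + 2) * y + y = (2 * real (Suc n) + 1) * y"
      "(2 * real n + 2) * y - y = (2 * real n + 1) * y" by (simp_all add: algebra_simps)
    ultimately show ?thesis by simp
  qed
  have "\<bar>2 * cos ((2 * real n + 2) * y) * sin y\<bar> \<le> 2 * \<bar>sin y\<bar>"
    by (simp add: abs_mult mult_left_le_one_le)
  then show ?case using Suc unfolding eq by (simp add: algebra_simps)
qed simp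

lemma square_wave_sum_bounded: "\<exists>K\<ge>0. \<forall>N y. \<bar>square_wave_sum N y\<bar> \<le> K"
proof -
  obtain B where B: "\<And>N. \<bar>square_wave_sum N (pi / 2)\<bar> \<le> B" "B > 0"
    using convergent_imp_Bseq[OF convergentI[OF square_wave_sum_half_pi]]
    unfolding Bseq_def real_norm_def by blast
  have "\<bar>square_wave_sum N y\<bar> \<le> B + 1" for N y
  \<comment> \<open>Below the threshold each of the \<open>N\<close> terms is at most
    \<open>\<bar>sin y\<bar>\<close>, so the sum is at most 1. Above it the tail estimate compares
    with the convergent, hence bounded, sequence at \<open>pi / 2\<close>.\<close>
  proof (cases "real N * \<bar>sin y\<bar> \<le> 1")
    case True
    have "\<bar>square_wave_sum N y\<bar> \<le> (\<Sum>n<N. \<bar>sin y\<bar>)"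
      unfolding square_wave_sum_def
    proof (rule sum_abs[THEN order_trans], rule sum_mono)
      fix n
      show "\<bar>sin ((2 * real n + 1) * y) / (2 * real n + 1)\<bar> \<le> \<bar>sin y\<bar>"
        using abs_sin_odd_multiple_le[of n y] by (simp add: field_simps)
    qed
    then show ?thesis using True B(2) by simp
  next
    case False
    then have y: "sin y \<noteq> 0" and N: "N > 0" by (auto intro: Nat.gr0I)
    have "1 / (2 * real N * \<bar>sin y\<bar>) \<le> 1" using False by (simp add: field_simps)
    moreover have "\<bar>sgn (sin y) * square_wave_sum N (pi / 2)\<bar> \<le> B"
      using y B(1)[of N] by (simp add: abs_mult abs_sgn_eq)
    ultimately show ?thesis using square_wave_sum_tail[OF y N] by linarith
  qed
  then show ?thesis using B(2) by (intro exI[of _ "B + 1"]) auto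
qed

subsection \<open>Box expansions of even periodic coefficients\<close>

text \<open>Orthogonality of the characters modulo \<open>2 * q\<close> in real form. Unless
  \<open>j\<close> is a multiple of \<open>2 * q\<close>, half the angle step has nonzero sine, and
  multiplying by twice that sine makes the sum telescope.\<close>

lemma sum_cos_roots_of_unity:
  fixes j :: int
  assumes q: "q > 0"
  shows "(\<Sum>m<2 * q. cos (pi * of_int j * real m / real q)) = (if 2 * int q dvd j then 2 * real q else 0)"
proof (cases "2 * int q dvd j")
  case True
  then obtain i where i: "j = 2 * int q * i" by blast
  have "cos (pi * of_int j * real m / real q) = 1" for m
  proof -
    have "pi * of_int j * real m / real q = 2 * pi * of_int (i * int m)" using q by (simp add: i)
    then show ?thesis by (simp only: cos_int_2pin)
  qed
  then show ?thesis using True by simp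
next
  case False
  define h where "h = pi * of_int j / (2 * real q)"
  have h: "sin h \<noteq> 0"
  proof
    assume "sin h = 0"
    then obtain i where "h = of_int i * pi" using sin_zero_iff_int2 by blast
    then have "real_of_int j = real_of_int (2 * int q * i)" using q by (simp add: h_def field_simps)
    then have "j = 2 * int q * i" by (simp only: of_int_eq_iff)
    then show False using False by simp
  qed
  have tele: "2 * sin h * (\<Sum>m<M. cos (2 * h * real m)) = sin ((2 * real M - 1) * h) + sin h" for M
  proof (induction M)
    case (Suc M)
    have "2 * sin h * cos (2 * h * real M) = sin (2 * h * real M + h) - sin (2 * h * real M - h)"
      by (simp add: sin_add sin_diff)
    also have "2 * h * real M + h = (2 * real (Suc M) - 1) * h" by (simp add: algebra_simps)
    also have "2 * h * real M - h = (2 * real M - 1) * h" by (simp add: algebra_simps)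
    finally show ?case using Suc by (simp add: distrib_left)
  qed simp
  \<comment> \<open>After \<open>2 * q\<close> terms the angle has advanced by a multiple of
    \<open>2 * pi\<close>, so the two ends of the telescoping sum cancel.\<close>
  have "(2 * real (2 * q) - 1) * h = 2 * pi * of_int j - h" using q by (simp add: h_def field_simps)
  then have "sin ((2 * real (2 * q) - 1) * h) = - sin h" by (simp only: sin_diff sin_int_2pin cos_int_2pin)
  then have "(\<Sum>m<2 * q. cos (2 * h * real m)) = 0" using tele[of "2 * q"] h by simp
  moreover have "2 * h * real m = pi * of_int j * real m / real q" for m using q by (simp add: h_def)
  ultimately show ?thesis using False by simp
qed

text \<open>Discrete Fourier inversion modulo \<open>2 * q\<close>. The product formula for cosines
  returns the mean of \<open>f k\<close> and \<open>f (- k)\<close>, so for even \<open>f\<close>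
  the cosines suffice.\<close>

lemma even_periodic_eq_cos_sum:
  fixes f :: "int \<Rightarrow> real"
  assumes q: "q > 0"
    and per: "\<And>k l. 2 * int q dvd k - l \<Longrightarrow> f k = f l"
    and even: "\<And>k. f (- k) = f k"
  obtains d where "\<And>k. f k = (\<Sum>m<2 * q. d m * cos (pi * of_int k * real m / real q))"
proof
  define R where "R = {0..<2 * int q}"
  define d where "d m = (\<Sum>r\<in>R. f r * cos (pi * of_int r * real m / real q)) / (2 * real q)" for m
  \<comment> \<open>The value of the root of unity sum: \<open>2 * q\<close> times the Kronecker
    delta modulo \<open>2 * q\<close>.\<close>
  define D where "D j = (if 2 * int q dvd j then 2 * real q else 0)" for j
  have pick: "(\<Sum>r\<in>R. f r * D (r - k)) = 2 * real q * f k" for k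
  proof -
    have "(\<Sum>r\<in>R. f r * D (r - k)) = (\<Sum>r\<in>R. if r = k mod (2 * int q) then f r * (2 * real q) else 0)"
    proof (rule sum.cong[OF refl])
      fix r assume "r \<in> R"
      then have "r mod (2 * int q) = r" by (simp add: R_def)
      then have "2 * int q dvd r - k \<longleftrightarrow> r = k mod (2 * int q)" by (simp add: mod_eq_dvd_iff[symmetric])
      then show "f r * D (r - k) = (if r = k mod (2 * int q) then f r * (2 * real q) else 0)"
        by (simp add: D_def)
    qed
    also have "\<dots> = f (k mod (2 * int q)) * (2 * real q)" using q by (simp add: R_def)
    also have "f (k mod (2 * int q)) = f k"
      by (intro per) (simp add: mod_eq_dvd_iff[symmetric])
    finally show ?thesis by simp
  qed
  fix k
  have prod: "(\<Sum>m<2 * q. cos (pi * of_int r * real m / real q) * cos (pi * of_int k * real m / real q))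
      = (D (r - k) + D (r - (- k))) / 2" for r
  proof -
    have "cos (pi * of_int r * real m / real q) * cos (pi * of_int k * real m / real q)
      = (cos (pi * of_int (r - k) * real m / real q) + cos (pi * of_int (r + k) * real m / real q)) / 2" for m
      by (simp add: cos_times_cos distrib_left distrib_right left_diff_distrib right_diff_distrib
          add_divide_distrib diff_divide_distrib)
    then have "(\<Sum>m<2 * q. cos (pi * of_int r * real m / real q) * cos (pi * of_int k * real m / real q))
      = ((\<Sum>m<2 * q. cos (pi * of_int (r - k) * real m / real q))
        + (\<Sum>m<2 * q. cos (pi * of_int (r + k) * real m / real q))) / 2"
      by (simp only: sum_divide_distrib[symmetric] sum.distrib)
    then show ?thesis unfolding sum_cos_roots_of_unity[OF q] D_def by simp
  qed
  have "(\<Sum>m<2 * q. d m * cos (pi * of_int k * real m / real q))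
      = (\<Sum>m<2 * q. \<Sum>r\<in>R. f r * (cos (pi * of_int r * real m / real q) * cos (pi * of_int k * real m / real q))) / (2 * real q)"
    by (simp add: d_def sum_divide_distrib sum_distrib_right mult.assoc)
  also have "(\<Sum>m<2 * q. \<Sum>r\<in>R. f r * (cos (pi * of_int r * real m / real q) * cos (pi * of_int k * real m / real q)))
      = (\<Sum>r\<in>R. f r * ((D (r - k) + D (r - (- k))) / 2))"
    by (subst sum.swap) (simp only: sum_distrib_left[symmetric] prod)
  also have "\<dots> = ((\<Sum>r\<in>R. f r * D (r - k)) + (\<Sum>r\<in>R. f r * D (r - (- k)))) / 2"
    by (simp add: sum.distrib[symmetric] sum_divide_distrib distrib_left)
  also have "\<dots> / (2 * real q) = f k"
    unfolding pick even using q by simp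
  finally show "f k = (\<Sum>m<2 * q. d m * cos (pi * of_int k * real m / real q))" ..
qed

text \<open>The sine changes sign only at multiples of \<open>pi\<close>, all of the form
  \<open>pi * j / q\<close>, so a cell stays within one half period. The index is an integer because
  translated cells may leave \<open>[0, 2 pi]\<close>.\<close>

lemma sgn_sin_grid_cell:
  fixes j :: int
  assumes q: "q > 0" and x: "pi * of_int j / real q < x" "x < pi * of_int (j + 1) / real q"
  shows "sgn (sin x) = (if even (j div int q) then 1 else - 1)"
proof -
  define i where "i = j div int q"
  have "j = i * int q + j mod int q" "0 \<le> j mod int q" "j mod int q < int q"
    using q by (simp_all add: i_def)
  then have "i * int q \<le> j" "j + 1 \<le> (i + 1) * int q"
    unfolding distrib_right by linarith+
  then have "of_int (i * int q) \<le> (of_int j :: real)" "of_int (j + 1) \<le> (of_int ((i + 1) * int q) :: real)"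
    by (simp_all only: of_int_le_iff)
  then have "pi * of_int (i * int q) / real q \<le> pi * of_int j / real q"
    "pi * of_int (j + 1) / real q \<le> pi * of_int ((i + 1) * int q) / real q"
    by (auto intro!: divide_right_mono mult_left_mono simp del: of_int_mult of_int_add)
  then have "pi * of_int i \<le> pi * of_int j / real q" "pi * of_int (j + 1) / real q \<le> pi * (of_int i + 1)"
    using q by simp_all
  then have "0 < sin (x - of_int i * pi)" using x by (intro sin_gt_zero) (auto simp: algebra_simps)
  moreover have "sin x = sin ((x - of_int i * pi) + pi * of_int i)" by simp
  then have "sin x = sin (x - of_int i * pi) * (if even i then 1 else - 1)"
    by (simp only: sin_add sin_npi_int cos_npi_int)
  ultimately show ?thesis unfolding i_def[symmetric] by (simp add: sgn_mult)
qed

section \<open>Box sums and the cells of the grid\<close>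

lemma box_sum_eq:
  assumes q: "q > 0" and j: "j < 2 * q"
    and x: "pi * real j / real q \<le> x" "x < pi * real (j + 1) / real q"
  shows "box_sum q c x = c j"
proof -
  have "box i q x = (if i = j then 1 else 0)" for i
  proof -
    have "x < pi * real (i + 1) / real q \<longleftrightarrow> x * real q / pi < real (i + 1)"
      "pi * real i / real q \<le> x \<longleftrightarrow> real i \<le> x * real q / pi"
      "real j \<le> x * real q / pi" "x * real q / pi < real (j + 1)"
      using q x by (simp_all add: field_simps)
    then show ?thesis unfolding box_def by auto
  qed
  then show ?thesis using j by (simp add: box_sum_def if_distrib[of "(*) _"] cong: if_cong)
qed

lemma off_grid_cell:
  assumes q: "q > 0" and x: "x \<in> {0..2 * pi} - grid q"
  obtains j where "j < 2 * q" "pi * real j / real q < x" "x < pi * real (j + 1) / real q"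
proof -
  define y where "y = x * real q / pi"
  define j where "j = nat \<lfloor>y\<rfloor>"
  have y: "0 \<le> y" "y \<le> 2 * real q" using x q by (auto simp: y_def field_simps)
  then have j: "real j \<le> y" "y < real (j + 1)" unfolding j_def by linarith+
  have jq: "j \<le> 2 * q" using j(1) y(2) by linarith
  have ne: "y \<noteq> real i" if "i \<le> 2 * q" for i
  proof
    assume "y = real i"
    then have "x = pi * real i / real q" using q by (simp add: y_def field_simps)
    then show False using x that unfolding grid_def by blast
  qed
  show thesis
  proof
    \<comment> \<open>Index \<open>2 * q\<close> would force \<open>x = 2 * pi\<close>, which is
      excluded as a point of \<open>grid q\<close>.\<close>
    show "j < 2 * q" using ne[of "2 * q"] j(1) y jq by (cases "j = 2 * q") auto
    show "pi * real j / real q < x" "x < pi * real (j + 1) / real q"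
      using ne[OF jq] j q by (auto simp: y_def field_simps)
  qed
qed

lemma grid_cell_off_grid:
  assumes q: "q > 0" and j: "j < 2 * q"
    and x: "pi * real j / real q < x" "x < pi * real (j + 1) / real q"
  shows "x \<in> {0..2 * pi} - grid q"
proof -
  have "x \<notin> grid q"
  proof
    assume "x \<in> grid q"
    then obtain i where "x = pi * real i / real q" unfolding grid_def by blast
    then have "real j < real i" "real i < real (j + 1)" using x q by (simp_all add: divide_less_cancel)
    then show False unfolding of_nat_less_iff by simp
  qed
  moreover have "0 \<le> pi * real j / real q" by simp
  then have "0 \<le> x" using x by linarith
  moreover have "pi * real (j + 1) / real q \<le> 2 * pi"
  proof -
    have "real (j + 1) \<le> 2 * real q" using j by linarith
    then have "pi * real (j + 1) \<le> pi * (2 * real q)" by (intro mult_left_mono) auto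
    then show ?thesis using q by (simp add: divide_le_eq mult_ac)
  qed
  then have "x \<le> 2 * pi" using x by linarith
  ultimately show ?thesis by simp
qed

lemma finite_grid: "finite (grid q)"
  unfolding grid_def by (rule finite_image_set) simp

text \<open>The midpoint of a cell lies off the grid; there the box sum is a single coefficient, and
  the sum of a series is unique.\<close>

lemma has_box_expansion_imp_determined:
  assumes q: "q > 0" and c: "has_box_expansion q f c"
  shows "determined_by_box_expansion q f c"
  unfolding determined_by_box_expansion_def
proof (intro conjI allI impI)
  fix c' j assume c': "has_box_expansion q f c'" and "j \<le> 2 * q - 1"
  then have j: "j < 2 * q" using q by simp
  define x where "x = pi * (real j + 1 / 2) / real q"
  have x: "pi * real j / real q < x" "x < pi * real (j + 1) / real q"
    using q by (simp_all add: x_def field_simps)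
  note sums = grid_cell_off_grid[OF q j x]
  have "box_sum q c' x = box_sum q c x"
    using c c' sums unfolding has_box_expansion_def by (blast intro: sums_unique2)
  then show "c' j = c j" using box_sum_eq[OF q j less_imp_le[OF x(1)] x(2)] by simp
qed fact

text \<open>Expanding \<open>f\<close> in cosines turns each partial sum into a finite combination
  of square wave sums translated by \<open>\<plusminus> pi m / q\<close>, which passes on their
  uniform bound. Such translations map cells to cells, so the limit is constant on each
  cell.\<close>

lemma even_periodic_box_expansion:
  fixes f :: "int \<Rightarrow> real"
  assumes q: "q > 0"
    and per: "\<And>k l. 2 * int q dvd k - l \<Longrightarrow> f k = f l"
    and even: "\<And>k. f (- k) = f k"
  defines "F \<equiv> \<lambda>n x. - (4 / pi) * (f (2 * int n + 1) / (2 * real n + 1) * sin ((2 * real n + 1) * x))"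
  obtains c K where "has_box_expansion q F c" "\<And>N x. \<bar>\<Sum>n<N. F n x\<bar> \<le> K"
proof -
  obtain d where d: "\<And>k. f k = (\<Sum>m<2 * q. d m * cos (pi * of_int k * real m / real q))"
    using even_periodic_eq_cos_sum[of q f] q per even by blast
  define h where "h m = pi * real m / real q" for m
  have partial: "(\<Sum>n<N. F n x)
      = (\<Sum>m<2 * q. - (2 / pi) * d m * (square_wave_sum N (x + h m) + square_wave_sum N (x - h m)))" for N x
  proof -
    have "F n x = (\<Sum>m<2 * q. - (2 / pi) * d m * (sin ((2 * real n + 1) * (x + h m)) / (2 * real n + 1)
         + sin ((2 * real n + 1) * (x - h m)) / (2 * real n + 1)))" for n
    proof -
      have "F n x = (\<Sum>m<2 * q. - (4 / pi) * d m *
          (sin ((2 * real n + 1) * x) * cos ((2 * real n + 1) * h m) / (2 * real n + 1)))"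
        unfolding F_def d h_def sum_divide_distrib sum_distrib_left sum_distrib_right
        by (intro sum.cong refl) (simp add: mult_ac)
      also have "\<dots> = (\<Sum>m<2 * q. - (2 / pi) * d m * (sin ((2 * real n + 1) * (x + h m)) / (2 * real n + 1)
         + sin ((2 * real n + 1) * (x - h m)) / (2 * real n + 1)))"
      proof (intro sum.cong refl)
        fix m
        have "sin ((2 * real n + 1) * (x + h m)) + sin ((2 * real n + 1) * (x - h m))
            = 2 * (sin ((2 * real n + 1) * x) * cos ((2 * real n + 1) * h m))"
          by (simp only: distrib_left[of "2 * real n + 1"] right_diff_distrib sin_add sin_diff)
        then show "- (4 / pi) * d m * (sin ((2 * real n + 1) * x) * cos ((2 * real n + 1) * h m) / (2 * real n + 1))
            = - (2 / pi) * d m * (sin ((2 * real n + 1) * (x + h m)) / (2 * real n + 1)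
              + sin ((2 * real n + 1) * (x - h m)) / (2 * real n + 1))"
          by (simp only: add_divide_distrib[symmetric])
      qed
      finally show ?thesis .
    qed
    then show ?thesis
      unfolding square_wave_sum_def sum_distrib_left sum.distrib[symmetric]
      by (simp only: ) (rule sum.swap)
  qed
  obtain B where B: "B \<ge> 0" "\<And>N y. \<bar>square_wave_sum N y\<bar> \<le> B"
    using square_wave_sum_bounded by blast
  define L where "L x = (\<Sum>m<2 * q. - (2 / pi) * d m *
      (pi / 4 * sgn (sin (x + h m)) + pi / 4 * sgn (sin (x - h m))))" for x
  \<comment> \<open>As \<open>L\<close> is constant on every open cell, its value can be read off at
    the midpoint.\<close>
  define c where "c j = L (pi * (real j + 1 / 2) / real q)" for j
  show thesis
  proof
    show "\<bar>\<Sum>n<N. F n x\<bar> \<le> (\<Sum>m<2 * q. \<bar>- (2 / pi) * d m\<bar> * (2 * B))" for N x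
      unfolding partial
    proof (rule sum_abs[THEN order_trans], rule sum_mono)
      fix m
      have "\<bar>square_wave_sum N (x + h m) + square_wave_sum N (x - h m)\<bar> \<le> 2 * B"
        using B(2)[of N "x + h m"] B(2)[of N "x - h m"] by linarith
      then show "\<bar>- (2 / pi) * d m * (square_wave_sum N (x + h m) + square_wave_sum N (x - h m))\<bar>
          \<le> \<bar>- (2 / pi) * d m\<bar> * (2 * B)"
        unfolding abs_mult[of "- (2 / pi) * d m"] by (intro mult_left_mono) auto
    qed
    show "has_box_expansion q F c"
      unfolding has_box_expansion_def
    proof
      fix x assume "x \<in> {0..2 * pi} - grid q"
      then obtain j where j: "j < 2 * q" and x: "pi * real j / real q < x" "x < pi * real (j + 1) / real q"
        using off_grid_cell[OF q] by blast
      \<comment> \<open>Used with \<open>i = 1\<close> and \<open>i = -1\<close>, which covers both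
        directions of translation.\<close>
      have sgn: "sgn (sin (y + s * h m)) = (if even ((int j + i * int m) div int q) then 1 else - 1)"
        if y: "pi * real j / real q < y" "y < pi * real (j + 1) / real q" and s: "s = of_int i" for y m s i
      proof (rule sgn_sin_grid_cell[OF q])
        have "pi * of_int (int j + i * int m) / real q = pi * real j / real q + s * h m"
          "pi * of_int (int j + i * int m + 1) / real q = pi * real (j + 1) / real q + s * h m"
          by (simp_all add: h_def s distrib_left add_divide_distrib mult_ac)
        then show "pi * of_int (int j + i * int m) / real q < y + s * h m"
          "y + s * h m < pi * of_int (int j + i * int m + 1) / real q"
          using y by (simp_all only: add_less_cancel_right)
      qed
      define z where "z = pi * (real j + 1 / 2) / real q"
      have z: "pi * real j / real q < z" "z < pi * real (j + 1) / real q"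
        using q by (simp_all add: z_def field_simps)
      have same: "sgn (sin (x + h m)) = sgn (sin (z + h m))" "sgn (sin (x - h m)) = sgn (sin (z - h m))" for m
        using sgn[OF x, of 1 1 m] sgn[OF z, of 1 1 m] sgn[OF x, of "-1" "-1" m] sgn[OF z, of "-1" "-1" m]
        by simp_all
      have ne: "sin (x + h m) \<noteq> 0" "sin (x - h m) \<noteq> 0" for m
      proof -
        have "sgn (sin (x + h m)) \<noteq> 0" "sgn (sin (x - h m)) \<noteq> 0"
          using sgn[OF x, of 1 1 m] sgn[OF x, of "-1" "-1" m] by (simp_all split: if_splits)
        then show "sin (x + h m) \<noteq> 0" "sin (x - h m) \<noteq> 0" by (simp_all add: sgn_zero_iff)
      qed
      have "(\<lambda>n. F n x) sums L x"
        unfolding sums_def partial L_def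
        by (intro tendsto_intros square_wave_sum_tendsto ne)
      moreover have "L x = c j" unfolding c_def z_def[symmetric] L_def same ..
      ultimately show "(\<lambda>n. F n x) sums box_sum q c x"
        using box_sum_eq[OF q j less_imp_le[OF x(1)] x(2)] by simp
    qed
  qed
qed

subsection \<open>Termwise integration\<close>

lemma bounded_convergence:
  fixes f :: "nat \<Rightarrow> real \<Rightarrow> real"
  assumes G: "finite G"
    and cont: "\<And>n. continuous_on {a..b} (f n)"
    and bound: "\<And>n x. x \<in> {a..b} \<Longrightarrow> \<bar>f n x\<bar> \<le> K"
    and lim: "\<And>x. x \<in> {a..b} - G \<Longrightarrow> (\<lambda>n. f n x) \<longlonglongrightarrow> g x"
  shows "g absolutely_integrable_on {a..b}"
    and "(\<lambda>n. integral {a..b} (f n)) \<longlonglongrightarrow> integral {a..b} g"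
proof -
  \<comment> \<open>The limit is known only off \<open>G\<close>. Replacing the values on
    \<open>G\<close> by 0 gives convergence everywhere and leaves the integrals unchanged.\<close>
  define cut where "cut h x = (if x \<in> G then 0 else h x)" for h :: "real \<Rightarrow> real" and x
  have int_cut: "integral {a..b} (cut h) = integral {a..b} h" for h
    by (rule integral_spike[OF negligible_finite[OF G]]) (simp add: cut_def)
  have 1: "cut (f n) integrable_on {a..b}" for n
    by (rule integrable_spike_finite[OF G _ integrable_continuous_real[OF cont]]) (simp add: cut_def)
  have 2: "(\<lambda>x. \<bar>K\<bar>) integrable_on {a..b}"
    by (rule integrable_continuous_real) simp
  have 3: "norm (cut (f n) x) \<le> \<bar>K\<bar>" if "x \<in> {a..b}" for n x
    using bound[OF that, of n] by (cases "x \<in> G") (auto simp: cut_def)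
  have 4: "(\<lambda>n. cut (f n) x) \<longlonglongrightarrow> cut g x" if "x \<in> {a..b}" for x
    using lim[of x] that by (simp add: cut_def)
  note conv = dominated_convergence[OF 1 2 3 4]
  have "norm (cut g x) \<le> \<bar>K\<bar>" if "x \<in> {a..b}" for x
    by (rule Lim_bounded[OF tendsto_norm[OF 4[OF that]]]) (use 3[OF that] in auto)
  then have "cut g absolutely_integrable_on {a..b}"
    by (rule absolutely_integrable_integrable_bound[OF _ conv(1) 2])
  then show "g absolutely_integrable_on {a..b}"
    by (rule absolutely_integrable_spike[OF _ negligible_finite[OF G]]) (simp add: cut_def)
  show "(\<lambda>n. integral {a..b} (f n)) \<longlonglongrightarrow> integral {a..b} g"
    using conv(2) unfolding int_cut .
qed

section \<open>Series with inverse powers of the odd numbers\<close>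

lemma summable_inverse_odd_squares: "summable (\<lambda>n. 1 / (2 * real n + 1)^2)"
proof (rule summable_comparison_test')
  show "summable (\<lambda>n. inverse (real (Suc n) ^ 2))"
    using inverse_power_summable[of 2, where 'a = real] by (subst summable_Suc_iff) simp
  fix n :: nat
  have "real (Suc n) ^ 2 \<le> (2 * real n + 1)^2" by (rule power_mono) auto
  then have "1 / (2 * real n + 1)^2 \<le> 1 / real (Suc n) ^ 2" by (intro divide_left_mono) auto
  then show "norm (1 / (2 * real n + 1)^2) \<le> inverse (real (Suc n) ^ 2)"
    by (simp add: inverse_eq_divide)
qed

text \<open>The bound depends on \<open>s\<close> only through \<open>K\<close>. For coefficients
  built from sines or cosines at a point it is therefore uniform in that point, as bounded
  convergence requires.\<close>

lemma summable_odd_square_bounded: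
  assumes "\<And>n. \<bar>s n\<bar> \<le> (K::real)"
  shows "summable (\<lambda>n. s n / (2 * real n + 1)^2)"
    and "\<bar>\<Sum>n<N. s n / (2 * real n + 1)^2\<bar> \<le> K * (\<Sum>n. 1 / (2 * real n + 1)^2)"
proof -
  have le: "\<bar>s n / (2 * real n + 1)^2\<bar> \<le> K * (1 / (2 * real n + 1)^2)" for n
    using assms[of n] by (simp add: divide_right_mono)
  show "summable (\<lambda>n. s n / (2 * real n + 1)^2)"
    by (rule summable_comparison_test'[OF summable_mult[OF summable_inverse_odd_squares, of K]])
      (use le in auto)
  have "K \<ge> 0" using assms[of 0] by linarith
  have "\<bar>\<Sum>n<N. s n / (2 * real n + 1)^2\<bar> \<le> (\<Sum>n<N. K * (1 / (2 * real n + 1)^2))"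
    by (rule sum_abs[THEN order_trans], rule sum_mono) (rule le)
  also have "\<dots> = K * (\<Sum>n<N. 1 / (2 * real n + 1)^2)" by (rule sum_distrib_left[symmetric])
  also have "\<dots> \<le> K * (\<Sum>n. 1 / (2 * real n + 1)^2)"
    by (intro mult_left_mono sum_le_suminf summable_inverse_odd_squares \<open>K \<ge> 0\<close>) auto
  finally show "\<bar>\<Sum>n<N. s n / (2 * real n + 1)^2\<bar> \<le> K * (\<Sum>n. 1 / (2 * real n + 1)^2)" .
qed

lemma summable_odd_cube_bounded:
  assumes "\<And>n. \<bar>s n\<bar> \<le> (K::real)"
  shows "summable (\<lambda>n. s n / (2 * real n + 1)^3)"
    and "\<bar>\<Sum>n<N. s n / (2 * real n + 1)^3\<bar> \<le> K * (\<Sum>n. 1 / (2 * real n + 1)^2)"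
proof -
  \<comment> \<open>One denominator factor, at least 1, is absorbed into the numerator.\<close>
  have eq: "s n / (2 * real n + 1)^3 = (s n / (2 * real n + 1)) / (2 * real n + 1)^2" for n
    by (simp add: power3_eq_cube power2_eq_square)
  have "\<bar>s n / (2 * real n + 1)\<bar> \<le> K" for n
  proof -
    have "\<bar>s n / (2 * real n + 1)\<bar> \<le> \<bar>s n\<bar> / 1"
      unfolding abs_divide by (rule divide_left_mono) auto
    then show ?thesis using assms[of n] by simp
  qed
  from summable_odd_square_bounded[OF this]
  show "summable (\<lambda>n. s n / (2 * real n + 1)^3)"
    "\<bar>\<Sum>n<N. s n / (2 * real n + 1)^3\<bar> \<le> K * (\<Sum>n. 1 / (2 * real n + 1)^2)"
    unfolding eq by auto
qed

text \<open>Inverse first powers give no summable majorant. Bounded partial sums with convergence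
  off a finite set still allow termwise integration.\<close>

lemma integral_box_sum_series:
  fixes s :: "nat \<Rightarrow> real"
  defines "F \<equiv> \<lambda>n x. - (4 / pi) * (s n / (2 * real n + 1) * sin ((2 * real n + 1) * x))"
  assumes b: "has_box_expansion q F b"
    and K: "\<And>N x. \<bar>\<Sum>n<N. F n x\<bar> \<le> K"
    and y: "y \<in> {0..2 * pi}"
  shows "box_sum q b absolutely_integrable_on {0..y}"
    and "(\<lambda>n. - (4 / pi) * (s n * (1 - cos ((2 * real n + 1) * y)) / (2 * real n + 1)^2))
           sums integral {0..y} (box_sum q b)"
proof -
  have cont: "continuous_on A (F n)" for A n
    unfolding F_def by (intro continuous_intros)
  have lim: "(\<lambda>N. \<Sum>n<N. F n x) \<longlonglongrightarrow> box_sum q b x" if "x \<in> {0..y} - grid q" for x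
    using b that y unfolding has_box_expansion_def sums_def by auto
  note conv = bounded_convergence[where a = 0 and b = y, OF finite_grid[of q] continuous_on_sum[OF cont] K lim]
  show "box_sum q b absolutely_integrable_on {0..y}" by (rule conv(1))
  have "integral {0..y} (F n) = - (4 / pi) * (s n * (1 - cos ((2 * real n + 1) * y)) / (2 * real n + 1)^2)" for n
  proof -
    define k where "k = 2 * real n + 1"
    have k: "k > 0" unfolding k_def by simp
    have "((\<lambda>x. - (4 / pi) * (s n / k * sin (k * x))) has_integral
        - (4 / pi) * (s n * (1 - cos (k * y)) / k^2) - - (4 / pi) * (s n * (1 - cos (k * 0)) / k^2)) {0..y}"
      using y k
      by (intro fundamental_theorem_of_calculus)
        (auto intro!: derivative_eq_intros simp: has_real_derivative_iff_has_vector_derivative[symmetric]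
          power2_eq_square)
    then have "(F n has_integral - (4 / pi) * (s n * (1 - cos ((2 * real n + 1) * y)) / (2 * real n + 1)^2)) {0..y}"
      unfolding F_def k_def by simp
    then show ?thesis by (rule integral_unique)
  qed
  then have "integral {0..y} (\<lambda>x. \<Sum>n<N. F n x)
      = (\<Sum>n<N. - (4 / pi) * (s n * (1 - cos ((2 * real n + 1) * y)) / (2 * real n + 1)^2))" for N
    by (subst integral_sum) (auto intro: integrable_continuous_real cont)
  then show "(\<lambda>n. - (4 / pi) * (s n * (1 - cos ((2 * real n + 1) * y)) / (2 * real n + 1)^2))
      sums integral {0..y} (box_sum q b)"
    using conv(2) unfolding sums_def by simp
qed

text \<open>In the once integrated terms, the constant in \<open>1 - cos\<close> integrates to the
  part linear in \<open>x\<close> and the cosine to the sine series with cubes. For sine phases the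
  linear part is \<open>beam_C t * x\<close>.\<close>

lemma beam_H_series:
  fixes s :: "nat \<Rightarrow> real"
  defines "F \<equiv> \<lambda>n x. - (4 / pi) * (s n / (2 * real n + 1) * sin ((2 * real n + 1) * x))"
  assumes b: "has_box_expansion q F b"
    and K: "\<And>N x. \<bar>\<Sum>n<N. F n x\<bar> \<le> K"
    and s: "\<And>n. \<bar>s n\<bar> \<le> 1"
    and x: "x \<in> {0..2 * pi}"
  shows "beam_H q b x = - (4 / pi) * (\<Sum>n. s n / (2 * real n + 1)^2) * x
           + (4 / pi) * (\<Sum>n. s n * sin ((2 * real n + 1) * x) / (2 * real n + 1)^3)"
proof -
  define I where "I n y = - (4 / pi) * (s n * (1 - cos ((2 * real n + 1) * y)) / (2 * real n + 1)^2)" for n y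
  have cont: "continuous_on A (I n)" for A n
    unfolding I_def by (intro continuous_intros) auto
  have bnd: "\<bar>\<Sum>n<N. I n y\<bar> \<le> (4 / pi) * (2 * (\<Sum>n. 1 / (2 * real n + 1)^2))" for N y
  proof -
    have "\<bar>s n * (1 - cos ((2 * real n + 1) * y))\<bar> \<le> 2" for n
    proof -
      have "\<bar>1 - cos ((2 * real n + 1) * y)\<bar> \<le> 2"
        using cos_le_one[of "(2 * real n + 1) * y"] cos_ge_minus_one[of "(2 * real n + 1) * y"] by linarith
      then show ?thesis using s[of n] mult_mono[of "\<bar>s n\<bar>" 1] by (simp add: abs_mult)
    qed
    from summable_odd_square_bounded(2)[OF this, where N = N]
    show ?thesis unfolding I_def sum_distrib_left[symmetric] abs_mult by (simp add: field_simps)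
  qed
  \<comment> \<open>The once integrated series converges at grid points too, so the exceptional set
    is empty.\<close>
  have lim: "(\<lambda>N. \<Sum>n<N. I n y) \<longlonglongrightarrow> integral {0..y} (box_sum q b)" if "y \<in> {0..x} - {}" for y
    using integral_box_sum_series(2)[OF b[unfolded F_def] K[unfolded F_def], of y] that x
    unfolding I_def sums_def by simp
  have "(\<lambda>N. integral {0..x} (\<lambda>y. \<Sum>n<N. I n y)) \<longlonglongrightarrow> beam_H q b x"
    unfolding beam_H_def
    by (rule bounded_convergence(2)[OF finite.emptyI continuous_on_sum[OF cont] bnd lim])
  moreover have "integral {0..x} (I n)
      = - (4 / pi) * (s n / (2 * real n + 1)^2 * x - s n * sin ((2 * real n + 1) * x) / (2 * real n + 1)^3)" for n
  proof -
    define k where "k = 2 * real n + 1"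
    have k: "k > 0" unfolding k_def by simp
    have "((\<lambda>x. - (4 / pi) * (s n * (1 - cos (k * x)) / k^2)) has_integral
        - (4 / pi) * (s n / k^2 * x - s n * sin (k * x) / k^3) - - (4 / pi) * (s n / k^2 * 0 - s n * sin (k * 0) / k^3)) {0..x}"
      using x k
      by (intro fundamental_theorem_of_calculus)
        (auto intro!: derivative_eq_intros simp: has_real_derivative_iff_has_vector_derivative[symmetric]
          power2_eq_square power3_eq_cube field_simps)
    then have "(I n has_integral - (4 / pi) * (s n / (2 * real n + 1)^2 * x
        - s n * sin ((2 * real n + 1) * x) / (2 * real n + 1)^3)) {0..x}"
      unfolding I_def[abs_def] k_def by simp
    then show ?thesis by (rule integral_unique)
  qed
  then have "integral {0..x} (\<lambda>y. \<Sum>n<N. I n y)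
      = (\<Sum>n<N. - (4 / pi) * (s n / (2 * real n + 1)^2 * x - s n * sin ((2 * real n + 1) * x) / (2 * real n + 1)^3))" for N
    by (subst integral_sum) (auto intro: integrable_continuous_real cont)
  ultimately have H: "(\<lambda>n. - (4 / pi) * (s n / (2 * real n + 1)^2 * x - s n * sin ((2 * real n + 1) * x) / (2 * real n + 1)^3))
      sums beam_H q b x"
    unfolding sums_def by simp
  have "\<bar>s n * sin ((2 * real n + 1) * x)\<bar> \<le> 1" for n
    using s[of n] by (simp add: abs_mult mult_le_one)
  then have "summable (\<lambda>n. s n * sin ((2 * real n + 1) * x) / (2 * real n + 1)^3)"
    by (rule summable_odd_cube_bounded(1))
  moreover have "summable (\<lambda>n. s n / (2 * real n + 1)^2)"
    using s by (rule summable_odd_square_bounded(1))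
  ultimately have "(\<lambda>n. - (4 / pi) * (s n / (2 * real n + 1)^2 * x - s n * sin ((2 * real n + 1) * x) / (2 * real n + 1)^3))
      sums (- (4 / pi) * ((\<Sum>n. s n / (2 * real n + 1)^2) * x - (\<Sum>n. s n * sin ((2 * real n + 1) * x) / (2 * real n + 1)^3)))"
    by (intro sums_mult sums_diff sums_mult2 summable_sums)
  from sums_unique2[OF H this] show ?thesis by (simp add: right_diff_distrib mult.assoc)
qed

text \<open>On a cell the inner integral is affine with slope \<open>b j\<close>, and one more
  integration yields the leading coefficient \<open>b j / 2\<close>.\<close>

lemma beam_H_quadratic:
  assumes q: "q > 0" and j: "j < 2 * q"
    and int: "box_sum q b integrable_on {0..2 * pi}"
  shows "\<exists>c0 c1. \<forall>x\<in>{pi * real j / real q..pi * real (j + 1) / real q}.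
           beam_H q b x = b j / 2 * x^2 + c1 * x + c0"
proof -
  define l r where "l = pi * real j / real q" and "r = pi * real (j + 1) / real q"
  define I where "I y = integral {0..y} (box_sum q b)" for y
  have l: "0 \<le> l" unfolding l_def by simp
  have r: "r \<le> 2 * pi"
  proof -
    have "real (j + 1) \<le> 2 * real q" using j by linarith
    then have "pi * real (j + 1) \<le> pi * (2 * real q)" by (intro mult_left_mono) auto
    then show ?thesis using q by (simp add: r_def divide_le_eq mult_ac)
  qed
  have I: "I y = I l + b j * (y - l)" if y: "y \<in> {l..r}" for y
  proof -
    have "integral {l..y} (box_sum q b) = integral {l..y} (\<lambda>_. b j)"
      \<comment> \<open>The half-open box omits its right end point \<open>r\<close>, a null
        set.\<close>
      by (rule integral_spike[of "{r}"]) (use y in \<open>auto simp: l_def r_def intro!: box_sum_eq[OF q j, symmetric]\<close>)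
    moreover have "I l + integral {l..y} (box_sum q b) = I y"
      unfolding I_def using y l r
      by (intro Henstock_Kurzweil_Integration.integral_combine integrable_on_subinterval[OF int]) auto
    ultimately show ?thesis using y by (simp add: mult.commute)
  qed
  have I_int: "I integrable_on {0..2 * pi}"
    unfolding I_def by (intro integrable_continuous_real indefinite_integral_continuous_1 int)
  have H: "beam_H q b x = beam_H q b l + (I l * (x - l) + b j * (x - l)^2 / 2)" if x: "x \<in> {l..r}" for x
  proof -
    have "integral {l..x} I = integral {l..x} (\<lambda>y. I l + b j * (y - l))"
      by (rule integral_cong, rule I) (use x in auto)
    also have "((\<lambda>y. I l + b j * (y - l)) has_integral
        (I l * (x - l) + b j * (x - l)^2 / 2) - (I l * (l - l) + b j * (l - l)^2 / 2)) {l..x}"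
      using x by (intro fundamental_theorem_of_calculus)
        (auto intro!: derivative_eq_intros simp: has_real_derivative_iff_has_vector_derivative[symmetric])
    then have "integral {l..x} (\<lambda>y. I l + b j * (y - l)) = I l * (x - l) + b j * (x - l)^2 / 2"
      by (simp add: integral_unique)
    finally have "integral {l..x} I = I l * (x - l) + b j * (x - l)^2 / 2" .
    moreover have "integral {0..l} I + integral {l..x} I = integral {0..x} I"
      using x l r by (intro Henstock_Kurzweil_Integration.integral_combine integrable_on_subinterval[OF I_int]) auto
    ultimately show ?thesis unfolding beam_H_def I_def[symmetric] by simp
  qed
  show ?thesis
  proof (intro exI ballI)
    fix x assume "x \<in> {pi * real j / real q..pi * real (j + 1) / real q}"
    then have "x \<in> {l..r}" unfolding l_def r_def .
    then show "beam_H q b x = b j / 2 * x^2 + (I l - b j * l) * x + (beam_H q b l - I l * l + b j * l^2 / 2)"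
      using H[of x] by (simp add: field_simps power2_eq_square)
  qed
qed

subsection \<open>Testing with trigonometric functions\<close>

text \<open>Each derivative contributes a factor \<open>m\<close> and a phase shift
  \<open>pi / 2\<close>; integrality of \<open>m\<close> gives the boundary conditions. The free
  phase \<open>\<theta>\<close> covers sines, cosines and constants at once.\<close>

lemma beam_test_function_sin:
  "beam_test_function (\<lambda>i x. of_int m ^ i * sin (of_int m * x + \<theta> + real i * (pi / 2)))"
  unfolding beam_test_function_def
proof (intro conjI allI impI ballI)
  fix i :: nat and x :: real
  have "of_int m * x + \<theta> + real (Suc i) * (pi / 2) = (of_int m * x + \<theta> + real i * (pi / 2)) + pi / 2"
    by (simp add: distrib_right)
  then have "sin (of_int m * x + \<theta> + real (Suc i) * (pi / 2)) = cos (of_int m * x + \<theta> + real i * (pi / 2))"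
    by (simp only: sin_add[of _ "pi / 2"]) simp
  then show "((\<lambda>x. of_int m ^ i * sin (of_int m * x + \<theta> + real i * (pi / 2))) has_real_derivative
      of_int m ^ Suc i * sin (of_int m * x + \<theta> + real (Suc i) * (pi / 2))) (at x within {0..2 * pi})"
    by (auto intro!: derivative_eq_intros)
next
  show "continuous_on {0..2 * pi} (\<lambda>x. of_int m ^ 4 * sin (of_int m * x + \<theta> + real 4 * (pi / 2)))"
    by (intro continuous_intros)
next
  fix i :: nat
  have "of_int m * (2 * pi) + \<theta> + real i * (pi / 2) = (of_int m * 0 + \<theta> + real i * (pi / 2)) + 2 * pi * of_int m"
    by simp
  then show "of_int m ^ i * sin (of_int m * 0 + \<theta> + real i * (pi / 2))
      = of_int m ^ i * sin (of_int m * (2 * pi) + \<theta> + real i * (pi / 2))"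
    by (simp only: sin_add[of _ "2 * pi * of_int m"] sin_int_2pin cos_int_2pin) simp
qed

lemma integral_sin_mult_sin_eq_0:
  fixes m :: int
  assumes "(2 * real n + 1)^2 \<noteq> (of_int m)^2"
  shows "integral {0..2 * pi} (\<lambda>x. sin ((2 * real n + 1) * x) * sin (of_int m * x + \<theta>)) = 0"
proof -
  define k where "k = 2 * real n + 1"
  \<comment> \<open>The numerator is the Wronskian of the two sines, whose derivative is
    \<open>k^2 - m^2\<close> times their product. Integer frequencies make it
    \<open>2 pi\<close>-periodic.\<close>
  define g where "g x = (of_int m * sin (k * x) * cos (of_int m * x + \<theta>)
      - k * cos (k * x) * sin (of_int m * x + \<theta>)) / (k^2 - (of_int m)^2)" for x
  have ne: "k^2 - (of_int m)^2 \<noteq> 0" using assms unfolding k_def by simp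
  have "((\<lambda>x. sin (k * x) * sin (of_int m * x + \<theta>)) has_integral g (2 * pi) - g 0) {0..2 * pi}"
  proof (rule fundamental_theorem_of_calculus)
    fix x
    have "((\<lambda>x. of_int m * sin (k * x) * cos (of_int m * x + \<theta>) - k * cos (k * x) * sin (of_int m * x + \<theta>))
        has_real_derivative (k^2 - (of_int m)^2) * (sin (k * x) * sin (of_int m * x + \<theta>))) (at x)"
      by (auto intro!: derivative_eq_intros simp: algebra_simps power2_eq_square)
    from DERIV_cdivide[OF this, of "k^2 - (of_int m)^2"]
    have "(g has_real_derivative sin (k * x) * sin (of_int m * x + \<theta>)) (at x)"
      unfolding g_def[abs_def] using ne by simp
    then show "(g has_vector_derivative sin (k * x) * sin (of_int m * x + \<theta>)) (at x within {0..2 * pi})"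
      unfolding has_real_derivative_iff_has_vector_derivative[symmetric]
      by (rule has_field_derivative_at_within)
  qed simp
  moreover have "g (2 * pi) = g 0"
  proof -
    have k: "k * (2 * pi) = 2 * pi * of_int (2 * int n + 1)" unfolding k_def by simp
    have m: "of_int m * (2 * pi) + \<theta> = \<theta> + 2 * pi * of_int m" by simp
    show ?thesis unfolding g_def k m
      by (simp only: sin_int_2pin cos_int_2pin sin_add cos_add) simp
  qed
  ultimately show ?thesis unfolding k_def by (simp add: integral_unique)
qed

lemma pairing_sine_series:
  fixes A :: "nat \<Rightarrow> real"
  defines "W \<equiv> \<lambda>N x. \<Sum>n<N. A n * sin ((2 * real n + 1) * x)"
  assumes G: "finite G"
    and bound: "\<And>N x. x \<in> {0..2 * pi} \<Longrightarrow> \<bar>W N x\<bar> \<le> K"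
    and lim: "\<And>x. x \<in> {0..2 * pi} - G \<Longrightarrow> (\<lambda>N. W N x) \<longlonglongrightarrow> w x"
    and \<phi>: "continuous_on {0..2 * pi} \<phi>" "\<And>x. \<bar>\<phi> x\<bar> \<le> 1"
  shows "(\<lambda>n. A n * integral {0..2 * pi} (\<lambda>x. sin ((2 * real n + 1) * x) * \<phi> x)) sums pairing w \<phi>"
proof -
  have "(\<lambda>N. integral {0..2 * pi} (\<lambda>x. W N x * \<phi> x)) \<longlonglongrightarrow> pairing w \<phi>"
    unfolding pairing_def
  proof (rule bounded_convergence(2)[OF G])
    show "continuous_on {0..2 * pi} (\<lambda>x. W N x * \<phi> x)" for N
      unfolding W_def by (intro continuous_intros \<phi>(1))
    show "\<bar>W N x * \<phi> x\<bar> \<le> K" if "x \<in> {0..2 * pi}" for N x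
      using mult_mono[OF bound[OF that, of N] \<phi>(2)[of x]] bound[OF that, of N] by (simp add: abs_mult)
    show "(\<lambda>N. W N x * \<phi> x) \<longlonglongrightarrow> w x * \<phi> x" if "x \<in> {0..2 * pi} - G" for x
      by (intro tendsto_intros lim that)
  qed
  moreover have "integral {0..2 * pi} (\<lambda>x. W N x * \<phi> x)
      = (\<Sum>n<N. A n * integral {0..2 * pi} (\<lambda>x. sin ((2 * real n + 1) * x) * \<phi> x))" for N
    unfolding W_def sum_distrib_right mult.assoc
    by (subst integral_sum) (auto intro!: integrable_continuous_real continuous_intros \<phi>(1))
  ultimately show ?thesis unfolding sums_def by simp
qed

text \<open>For \<open>r = 0\<close> the quotient below is \<open>0\<close>, so the formula stays true.\<close>

lemma harmonic_oscillator:
  fixes y v :: "real \<Rightarrow> real" and r :: real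
  assumes y: "\<And>t. t \<ge> 0 \<Longrightarrow> (y has_real_derivative v t) (at t within {0..})"
    and v: "\<And>t. t \<ge> 0 \<Longrightarrow> (v has_real_derivative - (r^2 * y t)) (at t within {0..})"
    and init: "v 0 = y 0" "r = 0 \<Longrightarrow> y 0 = 0"
    and t: "t \<ge> 0"
  shows "y t = y 0 * (cos (r * t) + sin (r * t) / r)"
proof -
  have const: "h t = h 0" if "\<And>t. t \<ge> 0 \<Longrightarrow> (h has_real_derivative 0) (at t within {0..})" for h :: "real \<Rightarrow> real"
  proof -
    have "\<exists>c. \<forall>x\<in>{0..}. h x = c"
      by (rule has_field_derivative_zero_constant) (use that in auto)
    then show ?thesis using t by force
  qed
  show ?thesis
  proof (cases "r = 0")
    case True
    \<comment> \<open>Without restoring force the velocity keeps its initial value, which equals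
      \<open>y 0\<close> and so vanishes.\<close>
    have "v s = 0" if "s \<ge> 0" for s
    proof -
      have "\<exists>c. \<forall>x\<in>{0..}. v x = c"
        by (rule has_field_derivative_zero_constant) (use v True in auto)
      then show ?thesis using that init True by force
    qed
    then have "y t = y 0" by (intro const) (use y in auto)
    then show ?thesis using init(2)[OF True] True by simp
  next
    case False
    \<comment> \<open>\<open>P\<close> and \<open>Q\<close> are the coordinates of the phase point
      \<open>(r * y, v)\<close> in a rotating frame, hence constants of motion. Rotating back
      recovers \<open>r * y t\<close>.\<close>
    define P where "P s = r * y s * cos (r * s) - v s * sin (r * s)" for s
    define Q where "Q s = r * y s * sin (r * s) + v s * cos (r * s)" for s
    have "P t = r * y 0"
      unfolding P_def[of 0, simplified, symmetric]
      by (rule const, unfold P_def[abs_def])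
        (auto intro!: derivative_eq_intros y v simp: power2_eq_square algebra_simps)
    moreover have "Q t = y 0"
      unfolding Q_def[of 0, simplified, unfolded init(1), symmetric]
      by (rule const, unfold Q_def[abs_def])
        (auto intro!: derivative_eq_intros y v simp: power2_eq_square algebra_simps)
    moreover have "P t * cos (r * t) + Q t * sin (r * t)
        = r * y t * ((sin (r * t))^2 + (cos (r * t))^2)"
      unfolding P_def Q_def by algebra
    ultimately have "r * y t = r * y 0 * cos (r * t) + y 0 * sin (r * t)"
      unfolding sin_cos_squared_add by simp
    then show ?thesis using False by (simp add: field_simps)
  qed
qed

subsection \<open>Completeness of the trigonometric system\<close>

lemma absolutely_integrable_mult_continuous:
  fixes v g :: "real \<Rightarrow> real"
  assumes v: "v absolutely_integrable_on {a..b}" and g: "continuous_on {a..b} g"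
  shows "(\<lambda>x. v x * g x) absolutely_integrable_on {a..b}"
proof -
  have "(\<lambda>x. g x * v x) absolutely_integrable_on {a..b}"
  proof (rule absolutely_integrable_bounded_measurable_product_real)
    show "g \<in> borel_measurable (lebesgue_on {a..b})"
      by (rule continuous_imp_measurable_on_sets_lebesgue[OF g]) simp
    show "bounded (g ` {a..b})"
      by (intro compact_imp_bounded compact_continuous_image g) simp
  qed (use v in auto)
  then show ?thesis by (simp only: mult.commute)
qed

text \<open>Multiplication by \<open>cos (x - \<alpha>)\<close> turns a sine of frequency
  \<open>m\<close> into half the sum of two sines of frequencies \<open>m + 1\<close> and
  \<open>m - 1\<close> with shifted phases. The induction must therefore range over all
  \<open>m\<close> and \<open>\<theta>\<close>.\<close>

lemma orthogonal_trig_imp_orthogonal_cos_power: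
  fixes v :: "real \<Rightarrow> real"
  assumes v: "v absolutely_integrable_on {a..b}"
    and orth: "\<And>(m::int) \<theta>. integral {a..b} (\<lambda>x. v x * sin (of_int m * x + \<theta>)) = 0"
  shows "integral {a..b} (\<lambda>x. v x * (cos (x - \<alpha>) ^ j * sin (of_int (m::int) * x + \<theta>))) = 0"
proof (induction j arbitrary: m \<theta>)
  case 0
  then show ?case using orth by simp
next
  case (Suc j)
  have eq: "v x * (cos (x - \<alpha>) ^ Suc j * sin (of_int m * x + \<theta>))
      = (v x * (cos (x - \<alpha>) ^ j * sin (of_int (m + 1) * x + (\<theta> - \<alpha>))))/2
        + (v x * (cos (x - \<alpha>) ^ j * sin (of_int (m - 1) * x + (\<theta> + \<alpha>))))/2" for x
  proof -
    have "of_int (m + 1) * x + (\<theta> - \<alpha>) = (of_int m * x + \<theta>) + (x - \<alpha>)"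
      "of_int (m - 1) * x + (\<theta> + \<alpha>) = (of_int m * x + \<theta>) - (x - \<alpha>)"
      by (simp_all add: algebra_simps)
    then have "sin (of_int (m + 1) * x + (\<theta> - \<alpha>)) + sin (of_int (m - 1) * x + (\<theta> + \<alpha>))
        = 2 * (cos (x - \<alpha>) * sin (of_int m * x + \<theta>))"
      by (simp only: sin_add[of "of_int m * x + \<theta>"] sin_diff[of "of_int m * x + \<theta>"]) simp
    then have "cos (x - \<alpha>) * sin (of_int m * x + \<theta>)
        = sin (of_int (m + 1) * x + (\<theta> - \<alpha>)) / 2 + sin (of_int (m - 1) * x + (\<theta> + \<alpha>)) / 2"
      by linarith
    then have "v x * cos (x - \<alpha>) ^ j * (cos (x - \<alpha>) * sin (of_int m * x + \<theta>)) = v x * cos (x - \<alpha>) ^ j *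
        (sin (of_int (m + 1) * x + (\<theta> - \<alpha>)) / 2 + sin (of_int (m - 1) * x + (\<theta> + \<alpha>)) / 2)"
      by (simp only:)
    then show ?thesis by (simp only: power_Suc distrib_left times_divide_eq_right mult_ac)
  qed
  have int: "(\<lambda>x. v x * (cos (x - \<alpha>) ^ j * sin (of_int (i::int) * x + c))) integrable_on {a..b}" for i c
    by (intro set_lebesgue_integral_eq_integral absolutely_integrable_mult_continuous v continuous_intros)
  show ?case
    unfolding eq
    by (subst Henstock_Kurzweil_Integration.integral_add)
      (auto simp only: integral_divide Suc.IH intro!: integrable_on_divide int)
qed

lemma orthogonal_trig_imp_orthogonal_continuous_cos:
  fixes v \<psi> :: "real \<Rightarrow> real"
  assumes v: "v absolutely_integrable_on {a..b}"
    and orth: "\<And>(m::int) \<theta>. integral {a..b} (\<lambda>x. v x * sin (of_int m * x + \<theta>)) = 0"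
    and \<psi>: "continuous_on {-1..1} \<psi>"
  shows "integral {a..b} (\<lambda>x. v x * \<psi> (cos (x - \<alpha>))) = 0"
proof -
  have "continuous_on {a..b} (\<lambda>x. \<psi> (cos (x - \<alpha>)))"
    by (rule continuous_on_compose2[OF \<psi>]) (auto intro!: continuous_intros)
  then have int_\<psi>: "(\<lambda>x. v x * \<psi> (cos (x - \<alpha>))) integrable_on {a..b}"
    by (intro set_lebesgue_integral_eq_integral absolutely_integrable_mult_continuous v)
  define M where "M = integral {a..b} (\<lambda>x. \<bar>v x\<bar>)"
  have abs_int: "(\<lambda>x. \<bar>v x\<bar>) integrable_on {a..b}"
    using v unfolding absolutely_integrable_on_def by simp
  have M: "M \<ge> 0" unfolding M_def by (rule Henstock_Kurzweil_Integration.integral_nonneg[OF abs_int]) simp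
  have "\<bar>integral {a..b} (\<lambda>x. v x * \<psi> (cos (x - \<alpha>)))\<bar> \<le> e * M" if e: "e > 0" for e
  proof -
    obtain g where g: "real_polynomial_function g" "\<And>x. x \<in> {-1..1} \<Longrightarrow> \<bar>\<psi> x - g x\<bar> < e"
      using Stone_Weierstrass_real_polynomial_function[OF _ \<psi> e] by auto
    obtain c n where c: "g = (\<lambda>x. \<Sum>i\<le>n. c i * x ^ i)"
      using g(1) unfolding real_polynomial_function_iff_sum by blast
    have pow_int: "(\<lambda>x. v x * cos (x - \<alpha>) ^ i) integrable_on {a..b}" for i
      by (intro set_lebesgue_integral_eq_integral absolutely_integrable_mult_continuous v continuous_intros)
    have gsum: "v x * g (cos (x - \<alpha>)) = (\<Sum>i\<le>n. c i * (v x * cos (x - \<alpha>) ^ i))" for x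
      unfolding c sum_distrib_left by (intro sum.cong refl) (simp add: mult_ac)
    have int_g: "(\<lambda>x. v x * g (cos (x - \<alpha>))) integrable_on {a..b}"
      unfolding gsum by (intro integrable_sum integrable_on_mult_right pow_int) auto
    \<comment> \<open>Frequency 0 with phase \<open>pi / 2\<close> makes the sine factor equal to
      1.\<close>
    have pow0: "integral {a..b} (\<lambda>x. v x * cos (x - \<alpha>) ^ i) = 0" for i
      using orthogonal_trig_imp_orthogonal_cos_power[OF v orth, of \<alpha> i 0 "pi / 2"] by simp
    have g0: "integral {a..b} (\<lambda>x. v x * g (cos (x - \<alpha>))) = 0"
      unfolding gsum by (subst integral_sum) (auto simp: pow0 intro!: integrable_on_mult_right pow_int)
    have diff: "integral {a..b} (\<lambda>x. v x * \<psi> (cos (x - \<alpha>)) - v x * g (cos (x - \<alpha>)))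
        = integral {a..b} (\<lambda>x. v x * \<psi> (cos (x - \<alpha>)))"
      by (simp add: Henstock_Kurzweil_Integration.integral_diff[OF int_\<psi> int_g] g0)
    have "norm (integral {a..b} (\<lambda>x. v x * \<psi> (cos (x - \<alpha>)) - v x * g (cos (x - \<alpha>))))
        \<le> integral {a..b} (\<lambda>x. e * \<bar>v x\<bar>)"
    proof (rule integral_norm_bound_integral)
      show "(\<lambda>x. v x * \<psi> (cos (x - \<alpha>)) - v x * g (cos (x - \<alpha>))) integrable_on {a..b}"
        by (intro Henstock_Kurzweil_Integration.integrable_diff int_\<psi> int_g)
      show "(\<lambda>x. e * \<bar>v x\<bar>) integrable_on {a..b}"
        by (intro integrable_on_mult_right abs_int)
      fix x
      have "\<bar>\<psi> (cos (x - \<alpha>)) - g (cos (x - \<alpha>))\<bar> \<le> e" using g(2)[of "cos (x - \<alpha>)"] by simp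
      then show "norm (v x * \<psi> (cos (x - \<alpha>)) - v x * g (cos (x - \<alpha>))) \<le> e * \<bar>v x\<bar>"
        using mult_left_mono[OF _ abs_ge_zero[of "v x"]]
        by (simp add: right_diff_distrib[symmetric] abs_mult mult.commute[of e])
    qed
    then show ?thesis unfolding diff by (simp add: M_def)
  qed
  note small = this
  show ?thesis
  proof (rule ccontr)
    assume "integral {a..b} (\<lambda>x. v x * \<psi> (cos (x - \<alpha>))) \<noteq> 0"
    then have pos: "\<bar>integral {a..b} (\<lambda>x. v x * \<psi> (cos (x - \<alpha>)))\<bar> > 0" (is "?I > 0") by simp
    \<comment> \<open>This choice of \<open>e\<close> brings the bound below half of
      \<open>?I\<close>; \<open>M + 1\<close> avoids division by 0 when \<open>M\<close>
      vanishes.\<close>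
    have "?I \<le> ?I / (2 * (M + 1)) * M" using pos M by (intro small) auto
    also have "\<dots> \<le> ?I / 2"
      using pos M by (simp add: field_simps)
    finally show False using pos by simp
  qed
qed

text \<open>Exhibits an interval as a superlevel set of a cosine centred at its midpoint. A point of
  \<open>[0, 2 pi]\<close> is at distance at most \<open>2 pi\<close> minus the half length from
  that midpoint, so the periodic copies of the interval are not reached.\<close>

lemma cos_diff_greater_iff:
  assumes cd: "0 \<le> c" "c < d" "d \<le> 2 * pi" and x: "x \<in> {0..2 * pi}"
  shows "cos ((d - c) / 2) < cos (x - (c + d) / 2) \<longleftrightarrow> x \<in> {c<..<d}"
proof -
  define \<beta> \<delta> where "\<beta> = (d - c) / 2" and "\<delta> = \<bar>x - (c + d) / 2\<bar>"
  have \<beta>: "0 < \<beta>" "\<beta> \<le> pi" using cd by (auto simp: \<beta>_def)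
  have \<delta>: "0 \<le> \<delta>" "\<delta> \<le> 2 * pi - \<beta>" using cd x by (auto simp: \<beta>_def \<delta>_def abs_le_iff field_simps)
  have "cos (x - (c + d) / 2) = cos \<delta>" unfolding \<delta>_def by simp
  moreover have "cos \<beta> < cos \<delta> \<longleftrightarrow> \<delta> < \<beta>"
  proof (cases "\<delta> \<le> pi")
    case True
    then show ?thesis using \<beta> \<delta> by (intro cos_mono_less_eq) auto
  next
    case False
    have "cos \<delta> = cos (2 * pi - \<delta>)" by (simp add: cos_diff)
    also have "\<dots> \<le> cos \<beta>" using \<beta> \<delta> False by (intro cos_monotone_0_pi_le) auto
    finally show ?thesis using False \<beta> by simp
  qed
  moreover have "\<delta> < \<beta> \<longleftrightarrow> x \<in> {c<..<d}" unfolding \<delta>_def \<beta>_def by (auto simp: abs_less_iff field_simps)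
  ultimately show ?thesis unfolding \<beta>_def by simp
qed

lemma orthogonal_trig_imp_integral_eq_0:
  fixes v :: "real \<Rightarrow> real"
  assumes v: "v absolutely_integrable_on {0..2 * pi}"
    and orth: "\<And>(m::int) \<theta>. integral {0..2 * pi} (\<lambda>x. v x * sin (of_int m * x + \<theta>)) = 0"
    and cd: "0 \<le> c" "c < d" "d \<le> 2 * pi"
  shows "integral {c..d} v = 0"
proof -
  define \<alpha> \<gamma> where "\<alpha> = (c + d) / 2" and "\<gamma> = cos ((d - c) / 2)"
  \<comment> \<open>Continuous ramps, 0 up to \<open>\<gamma>\<close>, converging to the indicator
    of values above \<open>\<gamma>\<close>. Composed with the cosine they converge to the indicator
    of \<open>{c<..<d}\<close>, and \<open>\<bar>v x\<bar>\<close> dominates the products.\<close>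
  define \<psi> where "\<psi> n s = min 1 (max 0 (real n * (s - \<gamma>)))" for n s
  have \<psi>_cont: "continuous_on A (\<psi> n)" for A n
    unfolding \<psi>_def by (intro continuous_intros)
  have \<psi>_lim: "(\<lambda>n. \<psi> n s) \<longlonglongrightarrow> (if \<gamma> < s then 1 else 0)" for s
  proof (cases "\<gamma> < s")
    case True
    obtain N where N: "1 / (s - \<gamma>) < real N" using reals_Archimedean2 by blast
    have "\<psi> n s = 1" if "n \<ge> N" for n
    proof -
      have "1 / (s - \<gamma>) < real n" using N that by linarith
      then have "1 < real n * (s - \<gamma>)" using True by (simp add: divide_less_eq)
      then show ?thesis by (simp add: \<psi>_def)
    qed
    then show ?thesis using True by (intro tendsto_eventually) (auto simp: eventually_sequentially)
  next
    case False
    then have "real n * (s - \<gamma>) \<le> 0" for n by (simp add: mult_nonneg_nonpos)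
    then have "\<psi> n s = 0" for n by (simp add: \<psi>_def max.absorb1)
    then show ?thesis using False by simp
  qed
  have comp_cont: "continuous_on {0..2 * pi} (\<lambda>x. \<psi> n (cos (x - \<alpha>)))" for n
    by (rule continuous_on_compose2[OF \<psi>_cont[of UNIV]]) (auto intro!: continuous_intros)
  have "(\<lambda>n. integral {0..2 * pi} (\<lambda>x. v x * \<psi> n (cos (x - \<alpha>))))
      \<longlonglongrightarrow> integral {0..2 * pi} (\<lambda>x. v x * (if \<gamma> < cos (x - \<alpha>) then 1 else 0))"
  proof (rule dominated_convergence(2)[where h = "\<lambda>x. \<bar>v x\<bar>"])
    show "(\<lambda>x. v x * \<psi> n (cos (x - \<alpha>))) integrable_on {0..2 * pi}" for n
      by (intro set_lebesgue_integral_eq_integral absolutely_integrable_mult_continuous v comp_cont)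
    show "(\<lambda>x. \<bar>v x\<bar>) integrable_on {0..2 * pi}"
      using v unfolding absolutely_integrable_on_def by simp
    show "norm (v x * \<psi> n (cos (x - \<alpha>))) \<le> \<bar>v x\<bar>" for n x
    proof -
      have "\<bar>\<psi> n (cos (x - \<alpha>))\<bar> \<le> 1" by (simp add: \<psi>_def)
      then show ?thesis by (simp add: abs_mult mult_left_le)
    qed
    show "(\<lambda>n. v x * \<psi> n (cos (x - \<alpha>))) \<longlonglongrightarrow> v x * (if \<gamma> < cos (x - \<alpha>) then 1 else 0)" for x
      by (intro tendsto_mult_left \<psi>_lim)
  qed
  then have "integral {0..2 * pi} (\<lambda>x. v x * (if \<gamma> < cos (x - \<alpha>) then 1 else 0)) = 0"
    by (simp add: orthogonal_trig_imp_orthogonal_continuous_cos[OF v orth \<psi>_cont] LIMSEQ_const_iff)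
  moreover have "integral {0..2 * pi} (\<lambda>x. v x * (if \<gamma> < cos (x - \<alpha>) then 1 else 0))
      = integral {0..2 * pi} (\<lambda>x. if x \<in> {c<..<d} then v x else 0)"
    by (rule integral_cong) (use cos_diff_greater_iff[OF cd] in \<open>simp add: \<alpha>_def \<gamma>_def\<close>)
  moreover have "\<dots> = integral {c<..<d} v"
  proof -
    have "{c<..<d} \<inter> {0..2 * pi} = {c<..<d}" using cd by auto
    then show ?thesis by (simp only: integral_restrict_Int)
  qed
  ultimately show ?thesis by (simp add: integral_open_interval_real)
qed

lemma integral_subintervals_eq_0_imp_AE_eq_0:
  fixes v :: "real \<Rightarrow> real"
  assumes v: "v integrable_on {a..b}"
    and zero: "\<And>c d. a \<le> c \<Longrightarrow> c < d \<Longrightarrow> d \<le> b \<Longrightarrow> integral {c..d} v = 0"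
  shows "AE x in lebesgue_on {a..b}. v x = 0"
proof -
  \<comment> \<open>Extension by zero makes the function integrable on every interval, as the
    differentiation theorem demands.\<close>
  define w where "w x = (if x \<in> {a..b} then v x else 0)" for x
  have "w integrable_on UNIV" unfolding w_def[abs_def] using v by (simp only: integrable_restrict_UNIV)
  then have "w integrable_on cbox c d" for c d by (rule integrable_on_subcbox) simp
  then obtain N where N: "negligible N"
    and lim: "\<And>x e. \<lbrakk>x \<notin> N; 0 < e\<rbrakk> \<Longrightarrow> \<exists>h0>0. \<forall>h. 0 < h \<and> h < h0 \<longrightarrow>
        norm (integral (cbox x (x + h *\<^sub>R One)) w /\<^sub>R h ^ DIM(real) - w x) < e"
    using integrable_ccontinuous_explicit[of w] by metis
  \<comment> \<open>The averages are taken to the right of \<open>x\<close>, so \<open>b\<close> is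
    set aside as one more null point.\<close>
  have "v x = 0" if x: "x \<in> {a..b}" "x \<notin> N \<union> {b}" for x
  proof (rule ccontr)
    assume "v x \<noteq> 0"
    then have "\<bar>w x\<bar> > 0" using x by (simp add: w_def)
    then obtain h0 where h0: "h0 > 0" "\<And>h. 0 < h \<Longrightarrow> h < h0 \<Longrightarrow> \<bar>integral {x..x + h} w / h - w x\<bar> < \<bar>w x\<bar>"
      using lim[of x "\<bar>w x\<bar>"] x by (auto simp: divide_inverse mult.commute)
    define h where "h = min (h0 / 2) (b - x)"
    have h: "0 < h" "h < h0" "x + h \<le> b" using h0(1) x by (auto simp: h_def)
    have "integral {x..x + h} w = integral {x..x + h} v"
      by (rule integral_cong) (use h x in \<open>auto simp: w_def\<close>)
    also have "\<dots> = 0" using zero[of x "x + h"] h x by simp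
    finally show False using h0(2)[OF h(1,2)] by simp
  qed
  then have "{x. \<not> (x \<in> {a..b} \<longrightarrow> v x = 0)} \<subseteq> N \<union> {b}" by auto
  moreover have "negligible (N \<union> {b})" using N by (simp add: negligible_Un)
  ultimately have "AE x in lebesgue. x \<in> {a..b} \<longrightarrow> v x = 0"
    unfolding eventually_ae_filter_negligible by blast
  then show ?thesis by (subst AE_restrict_space_iff) auto
qed

subsection \<open>Uniqueness of weak solutions\<close>

text \<open>For \<open>k = l + 2 q i\<close> the difference \<open>k^2 - l^2 = 2 q i (k + l)\<close>
  times \<open>pi p / q\<close> is an integer multiple of \<open>2 pi\<close>. The phase thus
  depends only on \<open>k\<close> modulo \<open>2 q\<close>. A general \<open>g\<close> covers
  cosine and sine.\<close>

lemma quadratic_phase_box_expansion: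
  fixes g :: "real \<Rightarrow> real" and p q :: nat
  assumes q: "q > 0" and g: "\<And>y (i::int). g (y + 2 * pi * of_int i) = g y"
  obtains c K where
    "has_box_expansion q (\<lambda>n x. - (4 / pi) * (g ((2 * real n + 1)^2 * (pi * real p / real q)) / (2 * real n + 1)
       * sin ((2 * real n + 1) * x))) c"
    "\<And>N x. \<bar>\<Sum>n<N. - (4 / pi) * (g ((2 * real n + 1)^2 * (pi * real p / real q)) / (2 * real n + 1)
       * sin ((2 * real n + 1) * x))\<bar> \<le> K"
proof -
  define f where "f k = g ((of_int k)^2 * (pi * real p / real q))" for k :: int
  have "f k = f l" if dvd: "2 * int q dvd k - l" for k l
  proof -
    obtain i where "k - l = 2 * int q * i" using dvd by blast
    then have i: "k = l + 2 * int q * i" by simp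
    have "(of_int k)^2 * (pi * real p / real q)
        = (of_int l)^2 * (pi * real p / real q) + 2 * pi * of_int (i * (k + l) * int p)"
      unfolding i using q by (simp add: field_simps power2_eq_square)
    then show ?thesis unfolding f_def by (simp only: g)
  qed
  moreover have "f (- k) = f k" for k unfolding f_def by simp
  ultimately obtain c K where cK:
    "has_box_expansion q (\<lambda>n x. - (4 / pi) * (f (2 * int n + 1) / (2 * real n + 1) * sin ((2 * real n + 1) * x))) c"
    "\<And>N x. \<bar>\<Sum>n<N. - (4 / pi) * (f (2 * int n + 1) / (2 * real n + 1) * sin ((2 * real n + 1) * x))\<bar> \<le> K"
    using even_periodic_box_expansion[of q f] q by blast
  have f: "f (2 * int n + 1) = g ((2 * real n + 1)^2 * (pi * real p / real q))" for n
    unfolding f_def by simp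
  show thesis by (rule that[OF cK[unfolded f]])
qed

lemma step_data_series:
  assumes "x \<in> {0..2 * pi} - {0, pi, 2 * pi}"
  shows "(\<lambda>N. - (4 / pi) * square_wave_sum N x) \<longlonglongrightarrow> step_data x"
proof -
  have *: "sin x \<noteq> 0 \<and> step_data x = - (4 / pi) * (pi / 4 * sgn (sin x))"
  proof (cases "x < pi")
    case True
    then have "sin x > 0" using assms by (intro sin_gt_zero) auto
    then show ?thesis using True by (simp add: step_data_def)
  next
    case False
    then have "sin x < 0" using assms by (intro sin_lt_zero) auto
    then show ?thesis using False assms by (simp add: step_data_def)
  qed
  show ?thesis
    unfolding *[THEN conjunct2] by (intro tendsto_mult tendsto_const square_wave_sum_tendsto *[THEN conjunct1])
qed

text \<open>The fourth derivative of the test sine is \<open>m^4\<close> times itself, which closes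
  the weak equation to an oscillator of frequency \<open>m^2\<close>. For \<open>m = 0\<close> a
  nonzero pairing would grow linearly while the quotient here is 0; the assumption
  \<open>mean\<close> excludes that case.\<close>

lemma beam_solution_pairing_sin:
  fixes m :: int
  assumes u: "beam_solution f f u"
    and mean: "m = 0 \<Longrightarrow> pairing f (\<lambda>x. sin (of_int m * x + \<theta>)) = 0"
    and t: "t \<ge> 0"
  shows "pairing (u t) (\<lambda>x. sin (of_int m * x + \<theta>)) = pairing f (\<lambda>x. sin (of_int m * x + \<theta>))
           * (cos ((of_int m)^2 * t) + sin ((of_int m)^2 * t) / (of_int m)^2)"
proof -
  define \<phi> where "\<phi> x = sin (of_int m * x + \<theta>)" for x :: real
  define \<Phi> where "\<Phi> i x = of_int m ^ i * sin (of_int m * x + \<theta> + real i * (pi / 2))" for i x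
  have \<Phi>0: "\<Phi> 0 = \<phi>" unfolding \<Phi>_def \<phi>_def by simp
  have "\<Phi> 4 x = ((of_int m)^2)^2 * \<phi> x" for x
  proof -
    have "of_int m * x + \<theta> + real 4 * (pi / 2) = of_int m * x + \<theta> + 2 * pi" by simp
    then show ?thesis unfolding \<Phi>_def \<phi>_def by (simp only: sin_periodic) simp
  qed
  then have \<Phi>4: "pairing h (\<Phi> 4) = ((of_int m)^2)^2 * pairing h \<phi>" for h
    unfolding pairing_def integral_mult_right[symmetric] by (simp only: mult.left_commute)
  have "beam_test_function \<Phi>"
    using beam_test_function_sin[of m \<theta>] unfolding \<Phi>_def .
  then obtain v where
    v: "\<And>t. t \<ge> 0 \<Longrightarrow> ((\<lambda>s. pairing (u s) (\<Phi> 0)) has_real_derivative v t) (at t within {0..})"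
    "\<And>t. t \<ge> 0 \<Longrightarrow> (v has_real_derivative - pairing (u t) (\<Phi> 4)) (at t within {0..})"
    "v 0 = pairing f (\<Phi> 0)"
    using u unfolding beam_solution_def by blast
  \<comment> \<open>The initial condition holds only almost everywhere, a difference that pairings
    do not see.\<close>
  have init: "pairing (u 0) \<phi> = pairing f \<phi>"
  proof -
    have "AE x in lebesgue_on {0..2 * pi}. u 0 x = f x" using u unfolding beam_solution_def by blast
    then have "AE x in lebesgue. x \<in> {0..2 * pi} \<longrightarrow> u 0 x = f x"
      by (subst (asm) AE_restrict_space_iff) auto
    then obtain N where "negligible N" "{x. \<not> (x \<in> {0..2 * pi} \<longrightarrow> u 0 x = f x)} \<subseteq> N"
      unfolding eventually_ae_filter_negligible by blast
    then show ?thesis unfolding pairing_def by (intro integral_spike[of N]) auto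
  qed
  have "pairing (u t) \<phi> = pairing (u 0) \<phi> * (cos ((of_int m)^2 * t) + sin ((of_int m)^2 * t) / (of_int m)^2)"
  proof (rule harmonic_oscillator[where v = v])
    show "((\<lambda>s. pairing (u s) \<phi>) has_real_derivative v t) (at t within {0..})" if "t \<ge> 0" for t
      using v(1)[OF that] unfolding \<Phi>0 .
    show "(v has_real_derivative - (((of_int m)^2)^2 * pairing (u t) \<phi>)) (at t within {0..})" if "t \<ge> 0" for t
      using v(2)[OF that] unfolding \<Phi>4 .
    show "v 0 = pairing (u 0) \<phi>" using v(3) init unfolding \<Phi>0 by simp
    show "pairing (u 0) \<phi> = 0" if "(of_int m)^2 = (0::real)"
      using mean that unfolding init by (simp add: \<phi>_def[abs_def])
  qed (rule t)
  then show ?thesis unfolding init unfolding \<phi>_def[abs_def] .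
qed

theorem theorem2p6:
  fixes p q :: nat
  assumes "p > 0" and "q > 0" and "coprime p q"
  shows "\<exists>a b :: nat \<Rightarrow> real.
    determined_by_box_expansion q
      (\<lambda>n x. - (4 / pi) * (cos ((2 * real n + 1)^2 * (pi * real p / real q)) / (2 * real n + 1)
                            * sin ((2 * real n + 1) * x))) a \<and>
    determined_by_box_expansion q
      (\<lambda>n x. - (4 / pi) * (sin ((2 * real n + 1)^2 * (pi * real p / real q)) / (2 * real n + 1)
                            * sin ((2 * real n + 1) * x))) b \<and>
    (\<forall>j\<le>2 * q - 1. \<exists>c0 c1. \<forall>x\<in>{pi * real j / real q..pi * real (j + 1) / real q}.
       beam_H q b x = b j / 2 * x^2 + c1 * x + c0) \<and>
    (\<forall>x\<in>{0..2 * pi} - grid q.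
       beam_series (pi * real p / real q) x
         = box_sum q a x - beam_H q b x + beam_C (pi * real p / real q) * x) \<and>
    (\<forall>u. beam_solution step_data step_data u \<longrightarrow>
       (AE x in lebesgue_on {0..2 * pi}.
          u (pi * real p / real q) x
            = box_sum q a x - beam_H q b x + beam_C (pi * real p / real q) * x))"
proof -
  define t where "t = pi * real p / real q"
  define S where "S = (\<Sum>n. 1 / (2 * real n + 1)^2)"
  have t: "t \<ge> 0" unfolding t_def by simp
  note q = \<open>q > 0\<close>
  have periodic: "cos (y + 2 * pi * of_int i) = cos y" "sin (y + 2 * pi * of_int i) = sin y" for y :: real and i
    by (simp_all add: sin_add cos_add)
  obtain a Ka where
    a: "has_box_expansion q (\<lambda>n x. - (4 / pi) * (cos ((2 * real n + 1)^2 * t) / (2 * real n + 1)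
          * sin ((2 * real n + 1) * x))) a"
    and Ka: "\<And>N x. \<bar>\<Sum>n<N. - (4 / pi) * (cos ((2 * real n + 1)^2 * t) / (2 * real n + 1)
          * sin ((2 * real n + 1) * x))\<bar> \<le> Ka"
    using quadratic_phase_box_expansion[of q cos p] q periodic(1) unfolding t_def by blast
  obtain b Kb where
    b: "has_box_expansion q (\<lambda>n x. - (4 / pi) * (sin ((2 * real n + 1)^2 * t) / (2 * real n + 1)
          * sin ((2 * real n + 1) * x))) b"
    and Kb: "\<And>N x. \<bar>\<Sum>n<N. - (4 / pi) * (sin ((2 * real n + 1)^2 * t) / (2 * real n + 1)
          * sin ((2 * real n + 1) * x))\<bar> \<le> Kb"
    using quadratic_phase_box_expansion[of q sin p] q periodic(2) unfolding t_def by blast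
  \<comment> \<open>\<open>w\<close> is to be identified both with the Fourier series off the grid
    and with the profile of every weak solution.\<close>
  define w where "w x = box_sum q a x - beam_H q b x + beam_C t * x" for x
  \<comment> \<open>The linear part of the double integral cancels against
    \<open>beam_C t * x\<close>.\<close>
  have H: "- beam_H q b x + beam_C t * x
      = - (4 / pi) * (\<Sum>n. sin ((2 * real n + 1)^2 * t) * sin ((2 * real n + 1) * x) / (2 * real n + 1)^3)"
    if "x \<in> {0..2 * pi}" for x
    using beam_H_series[OF b Kb _ that] by (simp add: beam_C_def)
  have A: "(\<lambda>n. cos ((2 * real n + 1)^2 * t) * sin ((2 * real n + 1) * x) / (2 * real n + 1))
      sums (box_sum q a x / (- (4 / pi)))" if "x \<in> {0..2 * pi} - grid q" for x
  proof -
    have "(\<lambda>n. - (4 / pi) * (cos ((2 * real n + 1)^2 * t) / (2 * real n + 1) * sin ((2 * real n + 1) * x)))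
        sums box_sum q a x"
      using a that unfolding has_box_expansion_def by blast
    from sums_divide[OF this, of "- (4 / pi)"] show ?thesis
      by (subst (asm) nonzero_mult_div_cancel_left) (simp_all only: times_divide_eq_left, simp)
  qed
  have cube: "\<bar>sin ((2 * real n + 1)^2 * t) * sin ((2 * real n + 1) * x)\<bar> \<le> 1" for n x
    by (simp add: abs_mult mult_le_one)
  have series: "beam_series t x = w x" if x: "x \<in> {0..2 * pi} - grid q" for x
  proof -
    have "- (4 / pi) * (\<Sum>n. cos ((2 * real n + 1)^2 * t) * sin ((2 * real n + 1) * x) / (2 * real n + 1))
        = box_sum q a x"
      unfolding sums_unique[OF A[OF x], symmetric] by simp
    then show ?thesis
      using H[of x] x unfolding beam_series_def w_def distrib_left by simp
  qed
  \<comment> \<open>Partial sums of both series merged. The cosine part is bounded through its box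
    expansion, the cubic part by absolute convergence, so pairings with \<open>w\<close> can be
    computed termwise.\<close>
  define W where "W N x = (\<Sum>n<N. - (4 / pi) * (cos ((2 * real n + 1)^2 * t) / (2 * real n + 1)
      + sin ((2 * real n + 1)^2 * t) / (2 * real n + 1)^3) * sin ((2 * real n + 1) * x))" for N x
  have W_split: "W N x = (\<Sum>n<N. - (4 / pi) * (cos ((2 * real n + 1)^2 * t) / (2 * real n + 1)
        * sin ((2 * real n + 1) * x)))
      + - (4 / pi) * (\<Sum>n<N. sin ((2 * real n + 1)^2 * t) * sin ((2 * real n + 1) * x) / (2 * real n + 1)^3)" for N x
    unfolding W_def sum_distrib_left sum.distrib[symmetric]
    by (intro sum.cong refl) (simp add: distrib_left distrib_right diff_divide_distrib left_diff_distrib)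
  have W_bound: "\<bar>W N x\<bar> \<le> Ka + 4 / pi * S" for N x
  proof -
    have "\<bar>\<Sum>n<N. sin ((2 * real n + 1)^2 * t) * sin ((2 * real n + 1) * x) / (2 * real n + 1)^3\<bar> \<le> S"
      using summable_odd_cube_bounded(2)[of "\<lambda>n. sin ((2 * real n + 1)^2 * t) * sin ((2 * real n + 1) * x)" 1, OF cube]
      by (simp add: S_def)
    then have "\<bar>- (4 / pi) * (\<Sum>n<N. sin ((2 * real n + 1)^2 * t) * sin ((2 * real n + 1) * x) / (2 * real n + 1)^3)\<bar>
        \<le> 4 / pi * S"
      unfolding abs_mult by (intro mult_mono) auto
    then show ?thesis unfolding W_split by (intro order_trans[OF abs_triangle_ineq] add_mono Ka)
  qed
  have W_lim: "(\<lambda>N. W N x) \<longlonglongrightarrow> w x" if x: "x \<in> {0..2 * pi} - grid q" for x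
  proof -
    have 1: "(\<lambda>N. \<Sum>n<N. - (4 / pi) * (cos ((2 * real n + 1)^2 * t) / (2 * real n + 1) * sin ((2 * real n + 1) * x)))
        \<longlonglongrightarrow> box_sum q a x"
      using a x unfolding has_box_expansion_def sums_def by blast
    have 2: "(\<lambda>N. \<Sum>n<N. sin ((2 * real n + 1)^2 * t) * sin ((2 * real n + 1) * x) / (2 * real n + 1)^3)
        \<longlonglongrightarrow> (\<Sum>n. sin ((2 * real n + 1)^2 * t) * sin ((2 * real n + 1) * x) / (2 * real n + 1)^3)"
      by (rule summable_LIMSEQ[OF summable_odd_cube_bounded(1)[OF cube]])
    have "w x = box_sum q a x + - (4 / pi) * (\<Sum>n. sin ((2 * real n + 1)^2 * t) * sin ((2 * real n + 1) * x) / (2 * real n + 1)^3)"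
      using H[of x] x unfolding w_def by simp
    then show ?thesis unfolding W_split by (simp only:) (intro tendsto_intros 1 2)
  qed
  have w: "w absolutely_integrable_on {0..2 * pi}"
  proof (rule bounded_convergence(1)[OF finite_grid[of q] _ W_bound W_lim])
    show "continuous_on {0..2 * pi} (W N)" for N
      unfolding W_def[abs_def] by (intro continuous_intros)
  qed

  obtain B where B: "\<And>N y. \<bar>square_wave_sum N y\<bar> \<le> B"
    using square_wave_sum_bounded by blast
  have step_sum: "(\<Sum>n<N. - (4 / pi) / (2 * real n + 1) * sin ((2 * real n + 1) * x))
      = - (4 / pi) * square_wave_sum N x" for N x
    unfolding square_wave_sum_def sum_distrib_left by simp
  define e where "e m \<theta> n = integral {0..2 * pi} (\<lambda>x. sin ((2 * real n + 1) * x) * sin (of_int m * x + \<theta>))"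
    for m :: int and \<theta> n
  have step_pair: "(\<lambda>n. - (4 / pi) / (2 * real n + 1) * e m \<theta> n)
      sums pairing step_data (\<lambda>x. sin (of_int m * x + \<theta>))" for m \<theta>
    unfolding e_def
  proof (rule pairing_sine_series[where G = "{0, pi, 2 * pi}" and K = "4 / pi * B"])
    show "\<bar>\<Sum>n<N. - (4 / pi) / (2 * real n + 1) * sin ((2 * real n + 1) * x)\<bar> \<le> 4 / pi * B" for N x
      unfolding step_sum abs_mult using B[of N x] by (intro mult_mono) auto
    show "(\<lambda>N. \<Sum>n<N. - (4 / pi) / (2 * real n + 1) * sin ((2 * real n + 1) * x)) \<longlonglongrightarrow> step_data x"
      if "x \<in> {0..2 * pi} - {0, pi, 2 * pi}" for x
      unfolding step_sum by (rule step_data_series[OF that])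
  qed (auto intro!: continuous_intros)
  have w_pair: "(\<lambda>n. - (4 / pi) * (cos ((2 * real n + 1)^2 * t) / (2 * real n + 1)
        + sin ((2 * real n + 1)^2 * t) / (2 * real n + 1)^3) * e m \<theta> n)
      sums pairing w (\<lambda>x. sin (of_int m * x + \<theta>))" for m \<theta>
    unfolding e_def
    by (rule pairing_sine_series[OF finite_grid[of q] W_bound[unfolded W_def] W_lim[unfolded W_def]])
      (auto intro!: continuous_intros)
  \<comment> \<open>By orthogonality only a term with \<open>(2 n + 1)^2 = m^2\<close> can survive,
    and there its factor is the oscillator factor. The two series agree term by term, and no pairing
    needs to be evaluated.\<close>
  have w_pair_eq: "pairing w (\<lambda>x. sin (of_int m * x + \<theta>)) = pairing step_data (\<lambda>x. sin (of_int m * x + \<theta>))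
      * (cos ((of_int m)^2 * t) + sin ((of_int m)^2 * t) / (of_int m)^2)" for m \<theta>
  proof -
    have "- (4 / pi) * (cos ((2 * real n + 1)^2 * t) / (2 * real n + 1)
          + sin ((2 * real n + 1)^2 * t) / (2 * real n + 1)^3) * e m \<theta> n
        = - (4 / pi) / (2 * real n + 1) * e m \<theta> n
          * (cos ((of_int m)^2 * t) + sin ((of_int m)^2 * t) / (of_int m)^2)" for n
    proof (cases "(2 * real n + 1)^2 = (of_int m)^2")
      case True
      have "c / k + d / k^3 = (c + d / k^2) / k" for c d k :: real
        by (simp add: add_divide_distrib power3_eq_cube power2_eq_square)
      then show ?thesis unfolding True[symmetric] by simp
    next
      case False
      then show ?thesis unfolding e_def by (simp add: integral_sin_mult_sin_eq_0)
    qed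
    from w_pair[of m \<theta>, unfolded this] sums_mult2[OF step_pair[of m \<theta>]]
    show ?thesis by (rule sums_unique2)
  qed
  \<comment> \<open>No odd frequency is 0, so every term of the pairing series vanishes.\<close>
  have step_mean: "pairing step_data (\<lambda>x. sin (of_int m * x + \<theta>)) = 0" if "m = 0" for m :: int and \<theta>
  proof -
    have "e m \<theta> n = 0" for n
      unfolding e_def using that by (intro integral_sin_mult_sin_eq_0) (simp add: add_nonneg_eq_0_iff)
    then show ?thesis using step_pair[of m \<theta>] sums_unique2[OF _ sums_zero] by simp
  qed
  have unique: "AE x in lebesgue_on {0..2 * pi}. u t x = w x" if u: "beam_solution step_data step_data u" for u
  proof -
    have ut: "u t absolutely_integrable_on {0..2 * pi}" using u t unfolding beam_solution_def by blast
    define v where "v x = u t x - w x" for x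
    have v: "v absolutely_integrable_on {0..2 * pi}"
      unfolding v_def[abs_def] by (intro set_integral_diff(1) ut w)
    have prod: "(\<lambda>x. h x * sin (of_int m * x + \<theta>)) integrable_on {0..2 * pi}"
      if "h absolutely_integrable_on {0..2 * pi}" for h and m :: int and \<theta>
      by (intro set_lebesgue_integral_eq_integral absolutely_integrable_mult_continuous that continuous_intros)
    \<comment> \<open>Both pairings equal the initial pairing times the same oscillator
      factor.\<close>
    have "integral {0..2 * pi} (\<lambda>x. v x * sin (of_int m * x + \<theta>)) = 0" for m :: int and \<theta>
    proof -
      have "integral {0..2 * pi} (\<lambda>x. v x * sin (of_int m * x + \<theta>))
          = pairing (u t) (\<lambda>x. sin (of_int m * x + \<theta>)) - pairing w (\<lambda>x. sin (of_int m * x + \<theta>))"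
        unfolding v_def left_diff_distrib pairing_def
        by (rule Henstock_Kurzweil_Integration.integral_diff[OF prod[OF ut] prod[OF w]])
      also have "\<dots> = 0"
        using beam_solution_pairing_sin[OF u step_mean t] w_pair_eq by simp
      finally show ?thesis .
    qed
    then have "integral {c..d} v = 0" if "0 \<le> c" "c < d" "d \<le> 2 * pi" for c d
      by (rule orthogonal_trig_imp_integral_eq_0[OF v _ that])
    then have "AE x in lebesgue_on {0..2 * pi}. v x = 0"
      by (rule integral_subintervals_eq_0_imp_AE_eq_0[OF set_lebesgue_integral_eq_integral(1)[OF v]])
    then show ?thesis by (simp add: v_def)
  qed
  have quadratic: "\<exists>c0 c1. \<forall>x\<in>{pi * real j / real q..pi * real (j + 1) / real q}.
      beam_H q b x = b j / 2 * x^2 + c1 * x + c0" if "j \<le> 2 * q - 1" for j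
    using that q
    by (intro beam_H_quadratic set_lebesgue_integral_eq_integral(1) integral_box_sum_series(1)[OF b Kb]) auto
  show ?thesis
    unfolding t_def[symmetric] w_def[symmetric]
    using has_box_expansion_imp_determined[OF q a] has_box_expansion_imp_determined[OF q b]
      quadratic series unique by (intro exI[of _ a] exI[of _ b]) (simp add: w_def)
qed

end
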